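(* Let $(M^7,g,\omega^3)$ be a $7$-dimensional $G_2$-manifold of type $\Lambda^0_1\oplus\Lambda^1_7\oplus\Lambda^3_{27}$, with associated vector field $\beta$ and $3$-form $\Gamma^3_{27}$ (see context). The torsion form of the unique affine connection $\nabla$ with totally skew-symmetric torsion preserving the structure ($\nabla\omega^3=0$) is given by $$T=\frac16\,(d\omega^3,*\omega^3)\cdot\omega^3-*d\omega^3+*(\beta\wedge\omega^3).$$ The vector field $\beta$ and the differential and codifferential of $\omega^3$ are related by $$\delta^g(\omega^3)=-(\beta\lrcorner\omega^3),\qquad d\omega^3=\frac17\,(d\omega^3,*\omega^3)\cdot( *\omega^3)+*\Gamma^3_{27}+\frac34\,(\beta\wedge\omega^3).$$
   Context: On $\mathbb R^7$ let $\omega^3=e_{127}+e_{135}-e_{146}-e_{236}-e_{245}+e_{347}+e_{567}$, $e_{ijk}=e_i\wedge e_j\wedge e_k$. A $G_2$-structure on an oriented Riemannian $7$-manifold $(M^7,g)$ is a $3$-form $\omega^3$ having this form in suitable local oriented orthonormal frames $e_1,\dots,e_7$ (vectors and covectors identified by $g$; orientation $e_1\wedge\dots\wedge e_7$). $(\cdot,\cdot)$ is the inner product on forms for which the $e_{i_1}\wedge\dots\wedge e_{i_p}$, $i_1<\dots<i_p$, are orthonormal; $*$ is the Hodge star; $\lrcorner$ is interior product; $\nabla^g$ is the Levi-Civita connection; $d\alpha=\sum e_i\wedge\nabla^g_{e_i}\alpha$, $\delta^g\alpha=-\sum e_i\lrcorner\nabla^g_{e_i}\alpha$. Let $\Lambda^3_{27}=\{\alpha\in\Lambda^3:\alpha\wedge\omega^3=0,\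 \alpha\wedge*\omega^3=0\}$. Type $\Lambda^0_1\oplus\Lambda^1_7\oplus\Lambda^3_{27}$ means that the $\Lambda^2_{14}$-component of the intrinsic torsion $\Gamma$ vanishes ($\Gamma$ is the $\mathfrak m$-part of the Levi-Civita form, $\mathfrak m=\mathfrak g_2^\perp\subset\mathfrak{so}(7)$, and $\mathbb R^7\otimes\mathfrak m=\Lambda^0_1\oplus\Lambda^1_7\oplus\Lambda^2_{14}\oplus\Lambda^3_{27}$). Equivalently there are a (unique) function $\lambda$, vector field $\beta$ and section $\Gamma^3_{27}$ of $\Lambda^3_{27}$ such that $$\nabla^g_X\omega^3=-\frac\lambda4(X\lrcorner*\omega^3)-\sum_{i=1}^7\Big(\frac14\beta\wedge X+\frac12X\lrcorner\Gamma^3_{27},\,e_i\lrcorner\omega^3\Big)(e_i\lrcorner*\omega^3)$$ for all $X$; this is the normalization of $\beta$ and $\Gamma^3_{27}$ used here. Such a structure admits a unique affine connection $\nabla$ with $\nabla\omega^3=0$ whose torsion form $T(X,Y,Z)=g(\nabla_XY-\nabla_YX-[X,Y],Z)$ is a $3$-form. *)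

theory Defs
  imports "HOL-Analysis.Analysis"
begin

section \<open>Exterior algebra of an oriented inner product space\<close>

text \<open>
  A form is a function on lists of vectors; a \<open>k\<close>-form vanishes on all lists whose length is
  not \<open>k\<close>. The vector space is \<open>real^7\<close> with its standard orientation, and \<open>h\<close> is an arbitrary
  inner product on it, since below \<open>real^7\<close> is the coordinate space of a chart and \<open>h\<close> the
  metric at a point.
\<close>

type_synonym form = "(real^7) list \<Rightarrow> real"
type_synonym bilin = "real^7 \<Rightarrow> real^7 \<Rightarrow> real"

definition kform :: "nat \<Rightarrow> form \<Rightarrow> bool" where
  "kform k \<alpha> \<longleftrightarrow>
     (\<forall>vs. length vs \<noteq> k \<longrightarrow> \<alpha> vs = 0) \<and>
     (\<forall>vs i. length vs = k \<and> i < k \<longrightarrow> linear (\<lambda>v. \<alpha> (vs[i := v]))) \<and>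
     (\<forall>vs i j. length vs = k \<and> i < j \<and> j < k \<and> vs ! i = vs ! j \<longrightarrow> \<alpha> vs = 0)"

text \<open>Sign of the shuffle that moves the positions in \<open>I\<close> in front of those not in \<open>I\<close>.\<close>

definition shuffle_sign :: "nat \<Rightarrow> nat set \<Rightarrow> real" where
  "shuffle_sign n I = (-1) ^ card {(i, j). i \<in> I \<and> j \<in> {..<n} - I \<and> j < i}"

text \<open>
  The wedge product is the sum over shuffles (no factorials). The degrees need not be given:
  if \<open>\<alpha>\<close> is a \<open>k\<close>-form, only the subsets \<open>I\<close> with \<open>k\<close> elements contribute.
\<close>

definition wedge :: "form \<Rightarrow> form \<Rightarrow> form" (infixr \<open>\<and>\<^sub>w\<close> 73) where
  "(\<alpha> \<and>\<^sub>w \<beta>) vs =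
     (\<Sum>I\<in>Pow {..<length vs}.
        shuffle_sign (length vs) I * \<alpha> (nths vs I) * \<beta> (nths vs (- I)))"

definition unit_form :: form where
  "unit_form vs = (if vs = [] then 1 else 0)"

definition interior :: "real^7 \<Rightarrow> form \<Rightarrow> form" (infixr \<open>\<lrcorner>\<close> 75) where
  "(v \<lrcorner> \<alpha>) vs = \<alpha> (v # vs)"

definition flat :: "bilin \<Rightarrow> real^7 \<Rightarrow> form" where
  "flat h v vs = (case vs of [u] \<Rightarrow> h v u | _ \<Rightarrow> 0)"

text \<open>A frame is the matrix with rows \<open>e$1,\<dots>,e$7\<close> (in the type \<open>7\<close>, \<open>7 = 0\<close>).\<close>

definition oriented_orthonormal :: "bilin \<Rightarrow> real^7^7 \<Rightarrow> bool" where
  "oriented_orthonormal h e \<longleftrightarrow>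
     (\<forall>i j. h (e $ i) (e $ j) = (if i = j then 1 else 0)) \<and> det e > 0"

text \<open>
  Inner product, Hodge star and frame sums do not depend on the oriented orthonormal frame; an
  arbitrary one is chosen.
\<close>

definition on_frame :: "bilin \<Rightarrow> real^7^7" where
  "on_frame h = (SOME e. oriented_orthonormal h e)"

definition frame_list :: "real^7^7 \<Rightarrow> (real^7) list" where
  "frame_list e = map (\<lambda>i. e $ i) [1, 2, 3, 4, 5, 6, 7]"

text \<open>
  With \<open>e\<^sub>I = nths (frame_list e) I\<close>, the number \<open>\<alpha> e\<^sub>I\<close> is the coefficient of \<open>\<alpha>\<close> at
  the basis form \<open>e\<^sub>i\<^sub>1 \<and> \<dots> \<and> e\<^sub>i\<^sub>p\<close>. Positions in the list run from \<open>0\<close> to \<open>6\<close>.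
\<close>

definition basis_form :: "bilin \<Rightarrow> real^7^7 \<Rightarrow> nat set \<Rightarrow> form" where
  "basis_form h e I = foldr (\<lambda>v \<alpha>. flat h v \<and>\<^sub>w \<alpha>) (nths (frame_list e) I) unit_form"

definition form_inner :: "bilin \<Rightarrow> form \<Rightarrow> form \<Rightarrow> real" where
  "form_inner h \<alpha> \<beta> =
     (\<Sum>I\<in>Pow {..<7}. \<alpha> (nths (frame_list (on_frame h)) I) * \<beta> (nths (frame_list (on_frame h)) I))"

text \<open>
  The linear map with \<open>*e\<^sub>I = \<plusminus> e\<^sub>J\<close>, \<open>J\<close> the complement of \<open>I\<close>, the sign being such that
  \<open>e\<^sub>I \<and> *e\<^sub>I = e\<^sub>1 \<and> \<dots> \<and> e\<^sub>7\<close>.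
\<close>

definition hodge :: "bilin \<Rightarrow> form \<Rightarrow> form" where
  "hodge h \<alpha> vs =
     (\<Sum>I\<in>Pow {..<7}. \<alpha> (nths (frame_list (on_frame h)) I) *
        shuffle_sign 7 I * basis_form h (on_frame h) ({..<7} - I) vs)"

definition e3 :: "bilin \<Rightarrow> real^7^7 \<Rightarrow> 7 \<Rightarrow> 7 \<Rightarrow> 7 \<Rightarrow> form" where
  "e3 h e i j k = flat h (e $ i) \<and>\<^sub>w flat h (e $ j) \<and>\<^sub>w flat h (e $ k)"

definition standard_G2_form :: "bilin \<Rightarrow> real^7^7 \<Rightarrow> form" where
  "standard_G2_form h e vs =
     e3 h e 1 2 7 vs + e3 h e 1 3 5 vs - e3 h e 1 4 6 vs - e3 h e 2 3 6 vs
     - e3 h e 2 4 5 vs + e3 h e 3 4 7 vs + e3 h e 5 6 7 vs"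

definition Lambda3_27 :: "bilin \<Rightarrow> form \<Rightarrow> form set" where
  "Lambda3_27 h \<omega> =
     {\<alpha>. kform 3 \<alpha> \<and> \<alpha> \<and>\<^sub>w \<omega> = (\<lambda>_. 0) \<and> \<alpha> \<and>\<^sub>w hodge h \<omega> = (\<lambda>_. 0)}"


section \<open>Oriented smooth 7-manifolds\<close>

primrec Ck_on :: "nat \<Rightarrow> (real^7) set \<Rightarrow> (real^7 \<Rightarrow> 'b::real_normed_vector) \<Rightarrow> bool" where
  "Ck_on 0 S f = continuous_on S f"
| "Ck_on (Suc k) S f =
     ((\<forall>x\<in>S. f differentiable (at x)) \<and>
      (\<forall>v. Ck_on k S (\<lambda>x. frechet_derivative f (at x) v)))"

text \<open>Only used for open \<open>S\<close>.\<close>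

definition smooth_on :: "(real^7) set \<Rightarrow> (real^7 \<Rightarrow> 'b::real_normed_vector) \<Rightarrow> bool" where
  "smooth_on S f \<longleftrightarrow> (\<forall>k. Ck_on k S f)"

type_synonym 'm chart = "'m set \<times> ('m \<Rightarrow> real^7)"

definition param :: "'m chart \<Rightarrow> real^7 \<Rightarrow> 'm" where
  "param c = inv_into (fst c) (snd c)"

definition transition :: "'m chart \<Rightarrow> 'm chart \<Rightarrow> real^7 \<Rightarrow> real^7" where
  "transition c c' = snd c' \<circ> param c"

definition jac :: "'m chart \<Rightarrow> 'm chart \<Rightarrow> 'm \<Rightarrow> real^7 \<Rightarrow> real^7" where
  "jac c c' p = frechet_derivative (transition c c') (at (snd c p))"

text \<open>
  The second derivative of the transition map at \<open>p\<close> in the directions \<open>u\<close>, \<open>v\<close>.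
\<close>

definition hess :: "'m chart \<Rightarrow> 'm chart \<Rightarrow> 'm \<Rightarrow> real^7 \<Rightarrow> real^7 \<Rightarrow> real^7" where
  "hess c c' p u v =
     frechet_derivative (\<lambda>x. frechet_derivative (transition c c') (at x) v) (at (snd c p)) u"

text \<open>
  The manifold \<open>M\<close> carries a smooth atlas all of whose coordinate changes preserve orientation; a
  basis at a point is positive if it is so in the charts of this atlas.
\<close>

definition oriented_manifold7 :: "'m topology \<Rightarrow> 'm chart set \<Rightarrow> bool" where
  "oriented_manifold7 M A \<longleftrightarrow>
     Hausdorff_space M \<and> second_countable M \<and> topspace M = \<Union> (fst ` A) \<and>
     (\<forall>c\<in>A. openin M (fst c) \<and> open (snd c ` fst c) \<and>
        homeomorphic_map (subtopology M (fst c)) (top_of_set (snd c ` fst c)) (snd c)) \<and>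
     (\<forall>c\<in>A. \<forall>c'\<in>A.
        smooth_on (snd c ` (fst c \<inter> fst c')) (transition c c') \<and>
        (\<forall>p\<in>fst c \<inter> fst c'. det (matrix (jac c c' p)) > 0))"


section \<open>Tensor fields and connections\<close>

text \<open>
  A tensor field is given by its components in every chart of the atlas, which transform in the
  usual way: the argument \<open>c\<close> is a chart, \<open>p\<close> a point of its domain, and tangent vectors at \<open>p\<close>
  are represented by their coordinate vectors in \<open>c\<close>. Values outside the domain of \<open>c\<close> are
  irrelevant.
\<close>

type_synonym 'm vfield = "'m chart \<Rightarrow> 'm \<Rightarrow> real^7"
type_synonym 'm fform = "'m chart \<Rightarrow> 'm \<Rightarrow> form"
type_synonym 'm metr = "'m chart \<Rightarrow> 'm \<Rightarrow> bilin"
type_synonym 'm conn = "'m chart \<Rightarrow> 'm \<Rightarrow> real^7 \<Rightarrow> real^7 \<Rightarrow> real^7"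

definition smooth_function :: "'m chart set \<Rightarrow> ('m \<Rightarrow> real) \<Rightarrow> bool" where
  "smooth_function A f \<longleftrightarrow> (\<forall>c\<in>A. smooth_on (snd c ` fst c) (\<lambda>x. f (param c x)))"

definition smooth_vector_field :: "'m chart set \<Rightarrow> 'm vfield \<Rightarrow> bool" where
  "smooth_vector_field A V \<longleftrightarrow>
     (\<forall>c\<in>A. smooth_on (snd c ` fst c) (\<lambda>x. V c (param c x))) \<and>
     (\<forall>c\<in>A. \<forall>c'\<in>A. \<forall>p\<in>fst c \<inter> fst c'. V c' p = jac c c' p (V c p))"

definition smooth_form :: "'m chart set \<Rightarrow> nat \<Rightarrow> 'm fform \<Rightarrow> bool" where
  "smooth_form A k \<alpha> \<longleftrightarrow>
     (\<forall>c\<in>A. \<forall>p\<in>fst c. kform k (\<alpha> c p)) \<and>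
     (\<forall>c\<in>A. \<forall>vs. smooth_on (snd c ` fst c) (\<lambda>x. \<alpha> c (param c x) vs)) \<and>
     (\<forall>c\<in>A. \<forall>c'\<in>A. \<forall>p\<in>fst c \<inter> fst c'. \<forall>vs. \<alpha> c p vs = \<alpha> c' p (map (jac c c' p) vs))"

definition riemannian_metric :: "'m chart set \<Rightarrow> 'm metr \<Rightarrow> bool" where
  "riemannian_metric A g \<longleftrightarrow>
     (\<forall>c\<in>A. \<forall>p\<in>fst c. bilinear (g c p) \<and> (\<forall>u v. g c p u v = g c p v u) \<and>
        (\<forall>u. u \<noteq> 0 \<longrightarrow> g c p u u > 0)) \<and>
     (\<forall>c\<in>A. \<forall>u v. smooth_on (snd c ` fst c) (\<lambda>x. g c (param c x) u v)) \<and>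
     (\<forall>c\<in>A. \<forall>c'\<in>A. \<forall>p\<in>fst c \<inter> fst c'. \<forall>u v.
        g c p u v = g c' p (jac c c' p u) (jac c c' p v))"

text \<open>
  An affine connection is given by its Christoffel symbols, \<open>\<nabla>\<^sub>u V = D\<^sub>u V + N(u, V)\<close> in
  every chart; the last condition is the transformation law which makes \<open>\<nabla>\<^sub>u V\<close> independent
  of the chart.
\<close>

definition affine_connection :: "'m chart set \<Rightarrow> 'm conn \<Rightarrow> bool" where
  "affine_connection A N \<longleftrightarrow>
     (\<forall>c\<in>A. \<forall>p\<in>fst c. bilinear (N c p)) \<and>
     (\<forall>c\<in>A. \<forall>u v. smooth_on (snd c ` fst c) (\<lambda>x. N c (param c x) u v)) \<and>
     (\<forall>c\<in>A. \<forall>c'\<in>A. \<forall>p\<in>fst c \<inter> fst c'. \<forall>u v.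
        jac c c' p (N c p u v) = hess c c' p u v + N c' p (jac c c' p u) (jac c c' p v))"

text \<open>In the next two definitions \<open>X\<close> and \<open>Y\<close> are vector fields written in the coordinates of \<open>c\<close>.\<close>

definition cov_vec ::
  "'m conn \<Rightarrow> 'm chart \<Rightarrow> 'm \<Rightarrow> (real^7 \<Rightarrow> real^7) \<Rightarrow> (real^7 \<Rightarrow> real^7) \<Rightarrow> real^7" where
  "cov_vec N c p X Y =
     frechet_derivative Y (at (snd c p)) (X (snd c p)) + N c p (X (snd c p)) (Y (snd c p))"

definition lie_bracket ::
  "'m chart \<Rightarrow> 'm \<Rightarrow> (real^7 \<Rightarrow> real^7) \<Rightarrow> (real^7 \<Rightarrow> real^7) \<Rightarrow> real^7" where
  "lie_bracket c p X Y =
     frechet_derivative Y (at (snd c p)) (X (snd c p))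
     - frechet_derivative X (at (snd c p)) (Y (snd c p))"

text \<open>
  \<open>T(X,Y,Z) = g(\<nabla>\<^sub>X Y - \<nabla>\<^sub>Y X - [X,Y], Z)\<close>. The right-hand side is tensorial, so the
  tangent vectors \<open>u\<close>, \<open>v\<close> are extended by constant coefficients.
\<close>

definition torsion_form :: "'m metr \<Rightarrow> 'm conn \<Rightarrow> 'm fform" where
  "torsion_form g N c p vs =
     (case vs of
        [u, v, w] \<Rightarrow>
          g c p (cov_vec N c p (\<lambda>_. u) (\<lambda>_. v) - cov_vec N c p (\<lambda>_. v) (\<lambda>_. u)
                 - lie_bracket c p (\<lambda>_. u) (\<lambda>_. v)) w
      | _ \<Rightarrow> 0)"

text \<open>\<open>(\<nabla>\<^sub>u \<alpha>)(v\<^sub>1,\<dots>,v\<^sub>k)\<close>, by the Leibniz rule applied to constant coordinate fields.\<close>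

definition cov_form :: "'m conn \<Rightarrow> 'm fform \<Rightarrow> 'm chart \<Rightarrow> 'm \<Rightarrow> real^7 \<Rightarrow> form" where
  "cov_form N \<alpha> c p u vs =
     frechet_derivative (\<lambda>x. \<alpha> c (param c x) vs) (at (snd c p)) u
     - (\<Sum>i<length vs. \<alpha> c p (vs[i := N c p u (vs ! i)]))"

definition parallel_form :: "'m chart set \<Rightarrow> 'm conn \<Rightarrow> 'm fform \<Rightarrow> bool" where
  "parallel_form A N \<alpha> \<longleftrightarrow> (\<forall>c\<in>A. \<forall>p\<in>fst c. \<forall>u vs. cov_form N \<alpha> c p u vs = 0)"

definition levi_civita :: "'m chart set \<Rightarrow> 'm metr \<Rightarrow> 'm conn \<Rightarrow> bool" where
  "levi_civita A g N \<longleftrightarrow>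
     affine_connection A N \<and>
     (\<forall>c\<in>A. \<forall>p\<in>fst c. \<forall>vs. torsion_form g N c p vs = 0) \<and>
     (\<forall>c\<in>A. \<forall>p\<in>fst c. \<forall>u v w.
        frechet_derivative (\<lambda>x. g c (param c x) v w) (at (snd c p)) u
        = g c p (N c p u v) w + g c p v (N c p u w))"

text \<open>In the next two definitions \<open>N\<close> is the Levi-Civita connection of \<open>g\<close>.\<close>

definition ext_d :: "'m metr \<Rightarrow> 'm conn \<Rightarrow> 'm fform \<Rightarrow> 'm fform" where
  "ext_d g N \<alpha> c p vs =
     (let e = on_frame (g c p) in
       \<Sum>i\<in>UNIV. (flat (g c p) (e $ i) \<and>\<^sub>w cov_form N \<alpha> c p (e $ i)) vs)"

definition codiff :: "'m metr \<Rightarrow> 'm conn \<Rightarrow> 'm fform \<Rightarrow> 'm fform" where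
  "codiff g N \<alpha> c p vs =
     (let e = on_frame (g c p) in
       - (\<Sum>i\<in>UNIV. (e $ i \<lrcorner> cov_form N \<alpha> c p (e $ i)) vs))"


section \<open>G2-structures\<close>

definition G2_structure :: "'m topology \<Rightarrow> 'm chart set \<Rightarrow> 'm metr \<Rightarrow> 'm fform \<Rightarrow> bool" where
  "G2_structure M A g \<omega> \<longleftrightarrow>
     smooth_form A 3 \<omega> \<and>
     (\<forall>c\<in>A. \<forall>p\<in>fst c. \<exists>W E. openin M W \<and> p \<in> W \<and> W \<subseteq> fst c \<and>
        smooth_on (snd c ` W) (\<lambda>x. E (param c x)) \<and>
        (\<forall>q\<in>W. oriented_orthonormal (g c q) (E q) \<and> \<omega> c q = standard_G2_form (g c q) (E q)))"

text \<open>
  The structure has type \<open>\<Lambda>\<^sup>0\<^sub>1 \<oplus> \<Lambda>\<^sup>1\<^sub>7 \<oplus> \<Lambda>\<^sup>3\<^sub>2\<^sub>7\<close>, with associated function \<open>lam\<close>,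
  vector field \<open>\<beta>\<close> and 3-form \<open>\<Gamma>\<close>; this also fixes the normalization of \<open>\<beta>\<close> and \<open>\<Gamma>\<close>.
  \<open>N\<close> is the Levi-Civita connection of \<open>g\<close>.
\<close>

definition G2_type_1_7_27 ::
  "'m chart set \<Rightarrow> 'm metr \<Rightarrow> 'm conn \<Rightarrow> 'm fform \<Rightarrow> ('m \<Rightarrow> real) \<Rightarrow> 'm vfield \<Rightarrow> 'm fform \<Rightarrow> bool"
where
  "G2_type_1_7_27 A g N \<omega> lam \<beta> \<Gamma> \<longleftrightarrow>
     smooth_function A lam \<and> smooth_vector_field A \<beta> \<and> smooth_form A 3 \<Gamma> \<and>
     (\<forall>c\<in>A. \<forall>p\<in>fst c. \<Gamma> c p \<in> Lambda3_27 (g c p) (\<omega> c p)) \<and>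
     (\<forall>c\<in>A. \<forall>p\<in>fst c. \<forall>X vs.
        let h = g c p; e = on_frame h; w = \<omega> c p in
        cov_form N \<omega> c p X vs =
          - (lam p / 4) * (X \<lrcorner> hodge h w) vs
          - (\<Sum>i\<in>UNIV.
               form_inner h
                 (\<lambda>us. 1/4 * (flat h (\<beta> c p) \<and>\<^sub>w flat h X) us + 1/2 * (X \<lrcorner> \<Gamma> c p) us)
                 (e $ i \<lrcorner> w)
               * (e $ i \<lrcorner> hodge h w) vs))"

end

(*
  Everything is pointwise. In a frame E_0,...,E_6 adapted to the 3-form w (0-based; it exists by
  the definition of a G2-structure), the hypothesis on the type says nabla^g_X w = sum_n c_n(X) E_n _| *w,
  where c_n(X) is, up to sign and a term in lambda, the pairing of E_n _| w with
  (beta ^ X)/4 + (X _| Gamma)/2.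
  Put B = nabla - nabla^g. Since nabla w = 0, nabla^g_X w is the infinitesimal action of the
  endomorphism B_X on w. Solving these linear equations for B_X in gl(7) shows that B_X is skew and
  determines its pairing with the forms E_n _| w. Hence B_X = (X _| T)/2, and the pairings
  determine T, because R^7 tensor g2 contains no nonzero 3-form. This gives
  T = -lambda/6 w - Gamma + 1/4 *(beta ^ w). Antisymmetrizing and contracting nabla^g w yields
  dw = -lambda *w + *Gamma + 3/4 beta ^ w and delta w = -beta _| w, whence (dw, *w) = -7 lambda.
*)

theory Submission
  imports Defs
begin

section \<open>Exterior algebra\<close>

text \<open>The inner product, the Hodge star, d and delta are defined through a frame picked by
  choice, which has no relation to the frame adapted to w. The main obstacle is to evaluate them in
  any oriented orthonormal frame. Traces of bilinear maps are frame-independent by orthogonality.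
  The inner product of k-forms follows by induction on k, since contracting with all frame vectors
  counts each k-subset k times. The star is an inner product with the contracted volume form, and
  the volume form is a quotient of determinants. After that, each claim is a finite system of linear
  identities in components. The constants come from contractions. With v = *w, summing over p and q,
  w_apq w_npq = 6 delta_an yields -lambda/6, v_mapq w_npq = 4 w_nma yields 1/4, and |v|^2 = 7 yields
  (dw, v) = -7 lambda. That Gamma has type 27 amounts to eight linear equations, and the components
  of dw and delta w agree modulo these. Skewness of B_X has a dimension count behind it: gl(7) acts
  on w with image all 35 dimensions of 3-forms and kernel g2, and the preimage of the forms v _| *w
  is exactly so(7).\<close>

lemma kform_length: "kform k \<alpha> \<Longrightarrow> length vs \<noteq> k \<Longrightarrow> \<alpha> vs = 0"
  by (simp add: kform_def)

lemma kform_linear: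
  assumes "kform k \<alpha>" "length us + length ws + 1 = k"
  shows "linear (\<lambda>v. \<alpha> (us @ v # ws))"
proof -
  have "linear (\<lambda>v. \<alpha> ((us @ 0 # ws)[length us := v]))"
    using assms unfolding kform_def by (metis add.commute add_Suc_right
        length_append length_Cons less_add_Suc1 plus_1_eq_Suc)
  then show ?thesis by simp
qed

lemma kform_repeat:
  assumes "kform k \<alpha>"
  shows "\<alpha> (us @ v # ws @ v # zs) = 0"
proof (cases "length (us @ v # ws @ v # zs) = k")
  case True
  let ?vs = "us @ v # ws @ v # zs"
  have "?vs ! length us = v" "?vs ! (length us + length ws + 1) = v"
    by (simp_all add: nth_append)
  then show ?thesis
    using assms True unfolding kform_def
    by (elim conjE) (erule allE[of _ ?vs], erule allE[of _ "length us"],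
        erule allE[of _ "length us + length ws + 1"], simp)
next
  case False
  then show ?thesis using assms kform_length by blast
qed

text \<open>Repeated arguments are displayed by list patterns instead of positions, so that later
  proofs work with append rather than index arithmetic.\<close>

lemma kformI:
  assumes len: "\<And>vs. length vs \<noteq> k \<Longrightarrow> \<alpha> vs = 0"
    and lin: "\<And>us ws. length us + length ws + 1 = k \<Longrightarrow> linear (\<lambda>v. \<alpha> (us @ v # ws))"
    and rep: "\<And>us v ws zs. length us + length ws + length zs + 2 = k \<Longrightarrow> \<alpha> (us @ v # ws @ v # zs) = 0"
  shows "kform k \<alpha>"
  unfolding kform_def
proof (intro conjI allI impI)
  show "\<alpha> vs = 0" if "length vs \<noteq> k" for vs using len that .
  show "linear (\<lambda>v. \<alpha> (vs[i := v]))" if "length vs = k \<and> i < k" for vs i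
    using lin[of "take i vs" "drop (Suc i) vs"] that by (simp add: upd_conv_take_nth_drop)
  show "\<alpha> vs = 0" if a: "length vs = k \<and> i < j \<and> j < k \<and> vs ! i = vs ! j" for vs i j
  proof -
    let ?ys = "drop (Suc i) vs" and ?m = "j - Suc i"
    have "vs = take i vs @ vs ! i # ?ys" by (rule id_take_nth_drop) (use a in simp)
    moreover have "?ys = take ?m ?ys @ ?ys ! ?m # drop (Suc ?m) ?ys"
      using a by (intro id_take_nth_drop) auto
    moreover have "?ys ! ?m = vs ! i" using a by simp
    ultimately have eq: "vs = take i vs @ vs ! i # take ?m ?ys @ vs ! i # drop (Suc ?m) ?ys"
      by metis
    have "\<alpha> (take i vs @ vs ! i # take ?m ?ys @ vs ! i # drop (Suc ?m) ?ys) = 0"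
      by (rule rep) (use a in auto)
    then show ?thesis using eq by simp
  qed
qed

lemma kform_swap:
  assumes "kform k \<alpha>"
  shows "\<alpha> (us @ a # b # ws) = - \<alpha> (us @ b # a # ws)"
proof (cases "length us + length ws + 2 = k")
  case True
  have l1: "linear (\<lambda>v. \<alpha> (us @ v # c # ws))" for c
    using kform_linear[OF assms, of us "c # ws"] True by simp
  have l2: "linear (\<lambda>v. \<alpha> (us @ c # v # ws))" for c
    using kform_linear[OF assms, of "us @ [c]" ws] True by simp
  have r: "\<alpha> (us @ c # c # ws) = 0" for c
    using kform_repeat[OF assms, of us c "[]" ws] by simp
  have "0 = \<alpha> (us @ (a + b) # (a + b) # ws)" by (simp add: r)
  also have "\<dots> = \<alpha> (us @ a # b # ws) + \<alpha> (us @ b # a # ws)"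
    by (simp only: linear_add[OF l1] linear_add[OF l2]) (simp add: r)
  finally show ?thesis by simp
next
  case False
  then show ?thesis using kform_length[OF assms] by simp
qed

lemma kform_move:
  assumes "kform k \<alpha>"
  shows "\<alpha> (us @ a # ws @ zs) = (-1) ^ length ws * \<alpha> (us @ ws @ a # zs)"
proof (induction ws arbitrary: us)
  case (Cons b ws)
  have "\<alpha> (us @ a # (b # ws) @ zs) = - \<alpha> ((us @ [b]) @ a # ws @ zs)"
    using kform_swap[OF assms, of us a b] by simp
  also have "\<dots> = - ((-1) ^ length ws * \<alpha> ((us @ [b]) @ ws @ a # zs))"
    using Cons.IH[of "us @ [b]"] by simp
  finally show ?case by simp
qed simp

lemma kform_append_left:
  assumes "kform (length us + k) \<alpha>"
  shows "kform k (\<lambda>vs. \<alpha> (us @ vs))"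
proof (rule kformI)
  show "linear (\<lambda>v. \<alpha> (us @ us' @ v # ws))" if "length us' + length ws + 1 = k" for us' ws
    using kform_linear[OF assms, of "us @ us'" ws] that by simp
  show "\<alpha> (us @ us' @ v # ws @ v # zs) = 0" for us' v ws zs
    using kform_repeat[OF assms, of "us @ us'" v ws zs] by simp
qed (use kform_length[OF assms] in auto)

lemma kform_append_right:
  assumes "kform (k + length ws) \<alpha>"
  shows "kform k (\<lambda>us. \<alpha> (us @ ws))"
proof (rule kformI)
  show "linear (\<lambda>v. \<alpha> ((us @ v # ws') @ ws))" if "length us + length ws' + 1 = k" for us ws'
    using kform_linear[OF assms, of us "ws' @ ws"] that by simp
  show "\<alpha> ((us @ v # ws' @ v # zs) @ ws) = 0" for us v ws' zs
    using kform_repeat[OF assms, of us v ws' "zs @ ws"] by simp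
qed (use kform_length[OF assms] in auto)

lemma interior_kform: "kform (Suc k) \<alpha> \<Longrightarrow> kform k (v \<lrcorner> \<alpha>)"
  using kform_append_left[of "[v]" k \<alpha>] by (simp add: interior_def[abs_def])

lemma interior_kform_0: "kform 0 \<alpha> \<Longrightarrow> v \<lrcorner> \<alpha> = (\<lambda>_. 0)"
  by (auto simp: interior_def kform_length)

lemma kform_zero: "kform k (\<lambda>_. 0)"
  by (rule kformI) (auto simp: linear_zero)

lemma kform_add: "kform k \<alpha> \<Longrightarrow> kform k \<beta> \<Longrightarrow> kform k (\<lambda>vs. \<alpha> vs + \<beta> vs)"
  by (rule kformI) (simp_all add: kform_length kform_repeat linear_compose_add[OF kform_linear kform_linear])

lemma kform_scale: "kform k \<alpha> \<Longrightarrow> kform k (\<lambda>vs. c * \<alpha> vs)"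
  by (rule kformI) (simp_all add: kform_length kform_repeat
      linear_compose_scale_right[OF kform_linear, simplified])

lemma kform_uminus: "kform k \<alpha> \<Longrightarrow> kform k (\<lambda>vs. - \<alpha> vs)"
  using kform_scale[of k \<alpha> "-1"] by simp

lemma kform_diff: "kform k \<alpha> \<Longrightarrow> kform k \<beta> \<Longrightarrow> kform k (\<lambda>vs. \<alpha> vs - \<beta> vs)"
  using kform_add[OF _ kform_uminus] by fastforce

lemma kform_sum: "(\<And>i. i \<in> I \<Longrightarrow> kform k (\<alpha> i)) \<Longrightarrow> kform k (\<lambda>vs. \<Sum>i\<in>I. \<alpha> i vs)"
  by (induction I rule: infinite_finite_induct) (auto simp: kform_zero kform_add)

text \<open>Supports induction on the degree. The contractions control every slot but the first; a
  repetition that involves the first slot is moved next to it and falls under the last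
  premise.\<close>

lemma kform_SucI:
  assumes nil: "\<alpha> [] = 0"
    and int: "\<And>u. kform k (u \<lrcorner> \<alpha>)"
    and lin: "\<And>vs. length vs = k \<Longrightarrow> linear (\<lambda>v. \<alpha> (v # vs))"
    and rep: "\<And>v vs. \<alpha> (v # v # vs) = 0"
  shows "kform (Suc k) \<alpha>"
proof (rule kformI)
  fix vs :: "(real^7) list" assume "length vs \<noteq> Suc k"
  then show "\<alpha> vs = 0"
    using nil kform_length[OF int] by (cases vs) (auto simp: interior_def)
next
  fix us ws :: "(real^7) list" assume "length us + length ws + 1 = Suc k"
  then show "linear (\<lambda>v. \<alpha> (us @ v # ws))"
    using lin kform_linear[OF int] by (cases us) (auto simp: interior_def)
next
  fix us ws zs :: "(real^7) list" and v assume "length us + length ws + length zs + 2 = Suc k"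
  show "\<alpha> (us @ v # ws @ v # zs) = 0"
  proof (cases us)
    case Nil
    then show ?thesis
      using kform_move[OF int, of v "[]" v ws zs] rep[of v "ws @ zs"]
      by (auto simp: interior_def)
  next
    case (Cons u us')
    then show ?thesis using kform_repeat[OF int, of u us' v ws zs] by (simp add: interior_def)
  qed
qed

lemma flat_kform: "bilinear h \<Longrightarrow> kform 1 (flat h v)"
  unfolding One_nat_def
  by (rule kform_SucI)
    (auto simp: flat_def interior_def bilinear_def intro!: kformI split: list.split list.split_asm)

section \<open>Recursion for shuffle sums and the wedge product\<close>

lemma Pow_lessThan_Suc:
  "Pow {..<Suc n} = insert 0 ` image Suc ` Pow {..<n} \<union> image Suc ` Pow {..<n}"
  by (simp add: lessThan_Suc_eq_insert_0 Pow_insert image_Pow_surj Un_commute)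

lemma sum_Pow_Suc:
  fixes F :: "nat set \<Rightarrow> 'a::comm_monoid_add"
  shows "(\<Sum>I\<in>Pow {..<Suc n}. F I) =
    (\<Sum>I\<in>Pow {..<n}. F (insert 0 (Suc ` I))) + (\<Sum>I\<in>Pow {..<n}. F (Suc ` I))"
proof -
  have inj: "inj_on (image Suc) (Pow {..<n})"
    by (rule inj_on_subset[OF inj_on_image_Pow[OF inj_on_subset[OF inj_Suc subset_UNIV]] order_refl])
  have inj0: "inj_on (insert 0) (image Suc ` Pow {..<n})"
    by (auto simp: inj_on_def insert_eq_iff)
  show ?thesis
    unfolding Pow_lessThan_Suc
    by (subst sum.union_disjoint) (auto simp: sum.reindex[OF inj] sum.reindex[OF inj0])
qed

lemma nths_Cons_insert_0: "nths (x # xs) (insert 0 (Suc ` I)) = x # nths xs I"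
  by (simp add: nths_Cons image_iff)

lemma nths_Cons_Suc: "nths (x # xs) (Suc ` I) = nths xs I"
  by (simp add: nths_Cons image_iff)

lemma nths_Cons_compl_insert_0: "nths (x # xs) (- insert 0 (Suc ` I)) = nths xs (- I)"
proof -
  have "{j. Suc j \<in> - insert 0 (Suc ` I)} = - I" by auto
  then show ?thesis by (simp add: nths_Cons)
qed

lemma nths_Cons_compl_Suc: "nths (x # xs) (- (Suc ` I)) = x # nths xs (- I)"
proof -
  have "{j. Suc j \<in> - (Suc ` I)} = - I" by auto
  then show ?thesis by (auto simp: nths_Cons)
qed

text \<open>Nothing lies in front of position 0, so putting it into the first block creates no
  inversion.\<close>

lemma shuffle_sign_insert_0: "shuffle_sign (Suc n) (insert 0 (Suc ` I)) = shuffle_sign n I"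
proof -
  have "{(i, j). i \<in> insert 0 (Suc ` I) \<and> j \<in> {..<Suc n} - insert 0 (Suc ` I) \<and> j < i} =
    map_prod Suc Suc ` {(i, j). i \<in> I \<and> j \<in> {..<n} - I \<and> j < i}" (is "?L = ?R")
  proof
    show "?L \<subseteq> ?R"
    proof
      fix x assume "x \<in> ?L"
      then obtain a b where x: "x = (a, b)"
        and ab: "a = 0 \<or> a \<in> Suc ` I" "b < Suc n" "b \<noteq> 0" "b \<notin> Suc ` I" "b < a" by auto
      then obtain a' b' where "a = Suc a'" "b = Suc b'" "a' \<in> I" by (cases b) auto
      then show "x \<in> ?R"
        using x ab by (intro image_eqI[of _ _ "(a', b')"]) auto
    qed
  qed auto
  moreover have "inj (map_prod Suc Suc)" by (simp add: prod.inj_map)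
  ultimately show ?thesis
    by (simp add: shuffle_sign_def card_image inj_on_subset[OF _ subset_UNIV])
qed

text \<open>Every element of \<open>I\<close> has to pass position 0, which belongs to the second
  block: the new inversions are the pairs \<open>(Suc i, 0)\<close>.\<close>

lemma shuffle_sign_Suc:
  assumes "I \<subseteq> {..<n}"
  shows "shuffle_sign (Suc n) (Suc ` I) = (-1) ^ card I * shuffle_sign n I"
proof -
  let ?S = "{(i, j). i \<in> I \<and> j \<in> {..<n} - I \<and> j < i}"
  have fin: "finite I" using assms finite_subset by blast
  have eq: "{(i, j). i \<in> Suc ` I \<and> j \<in> {..<Suc n} - Suc ` I \<and> j < i} =
    (\<lambda>i. (Suc i, 0)) ` I \<union> map_prod Suc Suc ` ?S" (is "?L = ?R")
  proof
    show "?L \<subseteq> ?R"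
    proof clarsimp
      fix i b assume i: "i \<in> I" and b: "b < Suc n" "b \<notin> Suc ` I" "b < Suc i"
        and n: "(Suc i, b) \<notin> map_prod Suc Suc ` {(i, j). i \<in> I \<and> j < n \<and> j \<notin> I \<and> j < i}"
      show "(Suc i, b) \<in> (\<lambda>i. (Suc i, 0)) ` I"
      proof (cases b)
        case 0
        then show ?thesis using i by auto
      next
        case (Suc b')
        then have "(Suc i, b) \<in> map_prod Suc Suc ` {(i, j). i \<in> I \<and> j < n \<and> j \<notin> I \<and> j < i}"
          using i b by (intro image_eqI[of _ _ "(i, b')"]) auto
        then show ?thesis using n by simp
      qed
    qed
  qed auto
  have "finite ?S"
    by (rule finite_subset[of _ "I \<times> {..<n}"]) (use fin in auto)
  moreover have "inj (map_prod Suc Suc)" by (simp add: prod.inj_map)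
  moreover have "inj_on (\<lambda>i. (Suc i, 0::nat)) I" by (simp add: inj_on_def)
  moreover have "(\<lambda>i. (Suc i, 0::nat)) ` I \<inter> map_prod Suc Suc ` ?S = {}" by auto
  ultimately have "card ((\<lambda>i. (Suc i, 0)) ` I \<union> map_prod Suc Suc ` ?S) = card I + card ?S"
    using fin by (simp add: card_Un_disjoint card_image inj_on_subset[OF _ subset_UNIV])
  then show ?thesis unfolding shuffle_sign_def eq by (simp add: power_add)
qed

lemma wedge_Nil: "(\<alpha> \<and>\<^sub>w \<beta>) [] = \<alpha> [] * \<beta> []"
  by (simp add: wedge_def shuffle_sign_def)

lemma length_nths_Pow: "I \<subseteq> {..<length xs} \<Longrightarrow> length (nths xs I) = card I"
  by (simp add: length_nths) (metis (no_types, lifting) Collect_cong Collect_mem_eq lessThan_iff subsetD)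

text \<open>Contraction is an antiderivation. The shuffles are sorted by the block that receives
  \<open>u\<close>.\<close>

lemma wedge_Cons:
  assumes "kform k \<alpha>"
  shows "(\<alpha> \<and>\<^sub>w \<beta>) (u # vs) = ((u \<lrcorner> \<alpha>) \<and>\<^sub>w \<beta>) vs + (-1) ^ k * (\<alpha> \<and>\<^sub>w (u \<lrcorner> \<beta>)) vs"
proof -
  let ?n = "length vs"
  \<comment> \<open>Only subsets with \<open>k\<close> elements contribute, because \<alpha>
    vanishes on lists of other lengths; hence \<open>card I\<close> may be replaced by
    \<open>k\<close> in the sign.\<close>
  have sgn: "shuffle_sign (Suc ?n) (Suc ` I) * \<alpha> (nths vs I) * c =
    (-1) ^ k * (shuffle_sign ?n I * \<alpha> (nths vs I) * c)" if "I \<in> Pow {..<?n}" for I c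
    using that shuffle_sign_Suc[of I ?n] kform_length[OF assms, of "nths vs I"]
    by (cases "card I = k") (auto simp: length_nths_Pow)
  then show ?thesis
    unfolding wedge_def
    by (simp add: sum_Pow_Suc nths_Cons_insert_0 nths_Cons_Suc nths_Cons_compl_insert_0
        nths_Cons_compl_Suc shuffle_sign_insert_0 interior_def sum_distrib_left sgn cong: sum.cong
        del: Pow_iff)
qed

lemma wedge_zero_left: "((\<lambda>_. 0) \<and>\<^sub>w \<beta>) = (\<lambda>_. 0)"
  by (rule ext) (simp add: wedge_def)

lemma wedge_zero_right: "(\<alpha> \<and>\<^sub>w (\<lambda>_. 0)) = (\<lambda>_. 0)"
  by (rule ext) (simp add: wedge_def)

lemma wedge_linear_left:
  assumes "\<And>us. linear (\<lambda>v. A v us)"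
  shows "linear (\<lambda>v. (A v \<and>\<^sub>w \<beta>) vs)"
  unfolding wedge_def
  by (intro linear_compose_sum ballI)
    (auto intro!: linearI simp: linear_add[OF assms] linear_scale[OF assms] algebra_simps)

lemma wedge_linear_right:
  assumes "\<And>us. linear (\<lambda>v. B v us)"
  shows "linear (\<lambda>v. (\<alpha> \<and>\<^sub>w B v) vs)"
  unfolding wedge_def
  by (intro linear_compose_sum ballI)
    (auto intro!: linearI simp: linear_add[OF assms] linear_scale[OF assms] algebra_simps)

lemma interior_linear:
  assumes "kform k \<alpha>"
  shows "linear (\<lambda>v. (v \<lrcorner> \<alpha>) us)"
proof (cases "Suc (length us) = k")
  case True
  then show ?thesis using kform_linear[OF assms, of "[]" us] by (simp add: interior_def)
next
  case False
  then show ?thesis using kform_length[OF assms] by (simp add: interior_def linear_zero)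
qed

lemma linear_add_scaled:
  fixes f g :: "'a::real_vector \<Rightarrow> real"
  shows "linear f \<Longrightarrow> linear g \<Longrightarrow> linear (\<lambda>v. f v + c * g v)"
  by (intro linearI) (auto simp: linear_add linear_scale algebra_simps)

text \<open>Induction on the total degree: by the antiderivation rule a contraction of the product
  is a sum of two products of total degree one less. Degree 0 in either factor needs care, since
  there the contraction is zero.\<close>

lemma wedge_kform:
  assumes "kform k \<alpha>" "kform l \<beta>"
  shows "kform (k + l) (\<alpha> \<and>\<^sub>w \<beta>)"
  using assms
proof (induction "k + l" arbitrary: k l \<alpha> \<beta>)
  case 0
  show ?case
  proof (rule kformI)
    fix vs :: "(real^7) list" assume "length vs \<noteq> k + l"
    then obtain u us where "vs = u # us" using 0 by (cases vs) auto
    then show "(\<alpha> \<and>\<^sub>w \<beta>) vs = 0"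
      using 0 by (simp add: wedge_Cons[of 0] interior_kform_0 wedge_zero_left wedge_zero_right)
  qed (use 0 in auto)
next
  case (Suc n)
  have L: "kform n ((u \<lrcorner> \<alpha>) \<and>\<^sub>w \<beta>)" for u
  proof (cases k)
    case 0
    then show ?thesis using Suc.prems by (simp add: interior_kform_0 wedge_zero_left kform_zero)
  next
    case (Suc k')
    then show ?thesis using Suc.hyps(1)[of k' l "u \<lrcorner> \<alpha>" \<beta>] \<open>Suc n = k + l\<close> Suc.prems interior_kform
      by simp
  qed
  have R: "kform n (\<alpha> \<and>\<^sub>w (u \<lrcorner> \<beta>))" for u
  proof (cases l)
    case 0
    then show ?thesis using Suc.prems by (simp add: interior_kform_0 wedge_zero_right kform_zero)
  next
    case (Suc l')
    then show ?thesis using Suc.hyps(1)[of k l' \<alpha> "u \<lrcorner> \<beta>"] \<open>Suc n = k + l\<close> Suc.prems interior_kform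
      by simp
  qed
  have eq: "u \<lrcorner> (\<alpha> \<and>\<^sub>w \<beta>) = (\<lambda>vs. ((u \<lrcorner> \<alpha>) \<and>\<^sub>w \<beta>) vs + (-1) ^ k * (\<alpha> \<and>\<^sub>w (u \<lrcorner> \<beta>)) vs)" for u
    using wedge_Cons[OF Suc.prems(1)] by (auto simp: interior_def)
  have "kform (Suc n) (\<alpha> \<and>\<^sub>w \<beta>)"
  proof (rule kform_SucI)
    show "(\<alpha> \<and>\<^sub>w \<beta>) [] = 0"
      using Suc.prems \<open>Suc n = k + l\<close> by (cases k) (auto simp: wedge_Nil kform_length)
    show "kform n (u \<lrcorner> (\<alpha> \<and>\<^sub>w \<beta>))" for u
      unfolding eq by (intro kform_add kform_scale L R)
    show "linear (\<lambda>v. (\<alpha> \<and>\<^sub>w \<beta>) (v # vs))" for vs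
      unfolding wedge_Cons[OF Suc.prems(1)]
      by (intro linear_add_scaled wedge_linear_left wedge_linear_right interior_linear)
        (fact Suc.prems)+
    \<comment> \<open>After two contractions with \<open>v\<close> only the mixed terms (v _|
      \<alpha>) ^ (v _| \<beta>) remain, with signs (-1)^(k-1) and (-1)^k, and they cancel.\<close>
    show "(\<alpha> \<and>\<^sub>w \<beta>) (v # v # vs) = 0" for v vs
    proof -
      have z: "v \<lrcorner> v \<lrcorner> \<gamma> = (\<lambda>_. 0)" if "kform m \<gamma>" for \<gamma> m
        using kform_repeat[OF that, of "[]" v "[]"] by (auto simp: interior_def)
      show ?thesis
      proof (cases k)
        case 0
        then show ?thesis using Suc.prems z[of l \<beta>]
          by (simp add: wedge_Cons[of 0] interior_kform_0 wedge_zero_left wedge_zero_right)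
      next
        case (Suc k')
        then show ?thesis
          using Suc.prems z[of l \<beta>] z[of k \<alpha>] wedge_Cons[of k' "v \<lrcorner> \<alpha>"] interior_kform[of k' \<alpha> v]
          by (simp add: wedge_Cons[of k \<alpha>] wedge_zero_left wedge_zero_right)
      qed
    qed
  qed
  then show ?case using Suc.hyps(2) by simp
qed

text \<open>
  The sublists of length \<open>k\<close>, each with its complement and its shuffle sign: a form in which the
  sums over \<open>Pow {..<n}\<close> of the definitions can be computed by rewriting.
\<close>

fun splits :: "nat \<Rightarrow> 'a list \<Rightarrow> (real \<times> 'a list \<times> 'a list) list" where
  "splits 0 xs = [(1, [], xs)]"
| "splits (Suc k) [] = []"
| "splits (Suc k) (x # xs) =
     map (\<lambda>(s, a, b). (s, x # a, b)) (splits k xs) @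
     map (\<lambda>(s, a, b). ((-1) ^ Suc k * s, a, x # b)) (splits (Suc k) xs)"

lemma card_insert_0_Suc: "finite I \<Longrightarrow> card (insert 0 (Suc ` I)) = Suc (card I)"
  by (simp add: card_image image_iff)

text \<open>\<open>F\<close> is arbitrary because the induction absorbs the head \<open>x\<close>
  and the new sign into it.\<close>

lemma sum_Pow_eq_splits:
  "(\<Sum>I\<in>Pow {..<length xs}. if card I = k then F (shuffle_sign (length xs) I) (nths xs I) (nths xs (- I)) else 0) =
   (\<Sum>(s, a, b)\<leftarrow>splits k xs. F s a b)"
proof (induction k xs arbitrary: F rule: splits.induct)
  case (1 xs)
  have "(\<Sum>I\<in>Pow {..<length xs}. if card I = 0 then F (shuffle_sign (length xs) I) (nths xs I) (nths xs (- I)) else 0)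
    = (\<Sum>I\<in>{{}}. F (shuffle_sign (length xs) I) (nths xs I) (nths xs (- I)))"
    by (rule sum.mono_neutral_cong_right) (auto simp: finite_subset)
  then show ?case by (simp add: shuffle_sign_def nths_all)
next
  case (2 k)
  then show ?case by simp
next
  case (3 k x xs)
  have c: "card (insert 0 (Suc ` I)) = Suc (card I)" "card (Suc ` I) = card I"
    "shuffle_sign (Suc (length xs)) (Suc ` I) = (-1) ^ card I * shuffle_sign (length xs) I"
    if "I \<in> Pow {..<length xs}" for I
    using that by (auto simp: card_insert_0_Suc finite_subset card_image shuffle_sign_Suc)
  show ?case
    using 3(1)[of "\<lambda>s a b. F s (x # a) b"] 3(2)[of "\<lambda>s a b. F ((-1) ^ Suc k * s) a (x # b)"]
    by (simp add: sum_Pow_Suc c nths_Cons_insert_0 nths_Cons_Suc nths_Cons_compl_insert_0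
        nths_Cons_compl_Suc shuffle_sign_insert_0 comp_def case_prod_beta cong: sum.cong if_cong
        del: Pow_iff)
qed

text \<open>The bridge between statements about index sets and lists that the simplifier can
  enumerate.\<close>

lemma set_splits:
  "set (splits k xs) =
   (\<lambda>I. (shuffle_sign (length xs) I, nths xs I, nths xs (- I))) ` {I \<in> Pow {..<length xs}. card I = k}"
proof (induction k xs rule: splits.induct)
  case (1 xs)
  have "{I \<in> Pow {..<length xs}. card I = 0} = {{}}"
    by (auto simp: finite_subset)
  then show ?case by (simp add: shuffle_sign_def nths_all)
next
  case (2 k)
  have "{I \<in> Pow {..<0::nat}. card I = Suc k} = {}" by auto
  then show ?case by simp
next
  case (3 k x xs)
  let ?n = "length xs"
  have *: "{I \<in> Pow {..<Suc ?n}. card I = Suc k} =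
    (\<lambda>I. insert 0 (Suc ` I)) ` {I \<in> Pow {..<?n}. card I = k} \<union>
    image Suc ` {I \<in> Pow {..<?n}. card I = Suc k}" (is "?L = ?R")
  proof
    show "?L \<subseteq> ?R"
    proof
      fix I assume I: "I \<in> ?L"
      have "I \<in> insert 0 ` image Suc ` Pow {..<?n} \<union> image Suc ` Pow {..<?n}"
        using I unfolding Pow_lessThan_Suc[symmetric] by blast
      then obtain J where J: "J \<in> Pow {..<?n}" "I = insert 0 (Suc ` J) \<or> I = Suc ` J" by auto
      then have "finite J" using finite_subset by auto
      then show "I \<in> ?R" using I J by (auto simp: card_insert_0_Suc card_image)
    qed
    show "?R \<subseteq> ?L"
      by (auto simp: card_insert_0_Suc finite_subset card_image)
  qed
  show ?case
    unfolding splits.simps set_append set_map 3 length_Cons * image_Un image_image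
    by (intro arg_cong2[where f = "(\<union>)"] image_cong)
      (auto simp: nths_Cons_insert_0 nths_Cons_Suc nths_Cons_compl_insert_0
        nths_Cons_compl_Suc shuffle_sign_insert_0 shuffle_sign_Suc)
qed

lemma wedge_splits:
  assumes "kform k \<alpha>"
  shows "(\<alpha> \<and>\<^sub>w \<beta>) vs = (\<Sum>(s, a, b)\<leftarrow>splits k vs. s * \<alpha> a * \<beta> b)"
  unfolding sum_Pow_eq_splits[symmetric] wedge_def
  by (rule sum.cong) (auto simp: kform_length[OF assms] length_nths_Pow)

lemma nths_cong: "(\<And>i. i < length xs \<Longrightarrow> i \<in> I \<longleftrightarrow> i \<in> J) \<Longrightarrow> nths xs I = nths xs J"
  unfolding nths_def by (rule arg_cong[where f = "map fst"], rule filter_cong) (auto simp: set_zip)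

text \<open>The sign is chosen before the form: it depends only on how many elements of
  \<open>J\<close> lie below \<open>i\<close>. In a product of the values of two forms it therefore
  squares to 1.\<close>

lemma kform_nths_insert:
  assumes "i < length xs" "i \<notin> J"
  shows "\<exists>s\<in>{1, -1::real}. \<forall>k \<alpha>. kform k \<alpha> \<longrightarrow> \<alpha> (xs ! i # nths xs J) = s * \<alpha> (nths xs (insert i J))"
proof -
  let ?A = "nths (take i xs) J" and ?B = "nths (drop (Suc i) xs) {j. j + Suc i \<in> J}"
  have xs: "take i xs @ xs ! i # drop (Suc i) xs = xs"
    using assms by (simp add: id_take_nth_drop[symmetric])
  have 1: "nths xs J = ?A @ ?B"
    using assms by (subst xs[symmetric], subst nths_append) (simp add: nths_Cons min_def)
  have "nths (take i xs) (insert i J) = ?A"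
    by (rule nths_cong) (use assms in auto)
  then have 2: "nths xs (insert i J) = ?A @ xs ! i # ?B"
    using assms by (subst xs[symmetric], subst nths_append) (simp add: nths_Cons min_def)
  show ?thesis
    unfolding 1 2 using kform_move[of _ _ "[]" "xs ! i" ?A ?B]
    by (intro bexI[of _ "(-1) ^ length ?A"])
      (auto simp: neg_one_even_power neg_one_odd_power elim: evenE, (metis neg_one_even_power neg_one_odd_power)?)
qed

lemma kform_nths_mem:
  assumes "kform k \<alpha>" "i < length xs" "i \<in> J"
  shows "\<alpha> (xs ! i # nths xs J) = 0"
proof -
  have "xs ! i \<in> set (nths xs J)" using assms by (auto simp: set_nths)
  then obtain A B where "nths xs J = A @ xs ! i # B" by (meson split_list)
  then show ?thesis using kform_repeat[OF assms(1), of "[]" "xs ! i" A B] by simp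
qed

text \<open>The prefix \<open>us\<close> is general because the induction moves the heads of the
  list into it. This connects the combinatorial sign with alternation, and gives the sign of the
  Hodge star.\<close>

lemma kform_shuffle:
  assumes "kform k \<alpha>" "I \<subseteq> {..<length xs}"
  shows "\<alpha> (us @ nths xs I @ nths xs (- I)) = shuffle_sign (length xs) I * \<alpha> (us @ xs)"
  using assms(2)
proof (induction xs arbitrary: us I)
  case Nil
  then show ?case by (simp add: shuffle_sign_def)
next
  case (Cons x xs)
  let ?n = "length xs"
  have "I \<in> insert 0 ` image Suc ` Pow {..<?n} \<union> image Suc ` Pow {..<?n}"
    using Cons.prems unfolding Pow_lessThan_Suc[symmetric] by simp
  then obtain J where J: "J \<subseteq> {..<?n}" "I = insert 0 (Suc ` J) \<or> I = Suc ` J" by auto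
  from J(2) show ?case
  proof
    assume I: "I = insert 0 (Suc ` J)"
    show ?thesis using Cons.IH[OF J(1), of "us @ [x]"]
      by (simp add: I nths_Cons_insert_0 nths_Cons_compl_insert_0 shuffle_sign_insert_0)
  next
    assume I: "I = Suc ` J"
    \<comment> \<open>Moving \<open>x\<close> behind the first block costs the same (-1)^(card J)
      that \<open>shuffle_sign_Suc\<close> records.\<close>
    have "\<alpha> (us @ x # nths xs J @ nths xs (- J)) =
      (-1) ^ card J * \<alpha> (us @ nths xs J @ x # nths xs (- J))"
      using kform_move[OF assms(1), of us x "nths xs J" "nths xs (- J)"] J(1)
      by (simp add: length_nths_Pow)
    then have "\<alpha> (us @ nths xs J @ x # nths xs (- J)) =
      (-1) ^ card J * \<alpha> (us @ x # nths xs J @ nths xs (- J))"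
      by (metis (no_types, lifting) left_minus_one_mult_self)
    then show ?thesis using Cons.IH[OF J(1), of "us @ [x]"]
      by (simp add: I nths_Cons_Suc nths_Cons_compl_Suc shuffle_sign_Suc[OF J(1)])
  qed
qed

section \<open>Independence of the oriented orthonormal frame\<close>

lemma exhaust_7:
  fixes x :: 7
  shows "x = 1 \<or> x = 2 \<or> x = 3 \<or> x = 4 \<or> x = 5 \<or> x = 6 \<or> x = 7"
proof (induct x)
  case (of_int z)
  then have "z = 0 \<or> z = 1 \<or> z = 2 \<or> z = 3 \<or> z = 4 \<or> z = 5 \<or> z = 6" by fastforce
  then show ?case by auto
qed

lemma UNIV_7: "(UNIV :: 7 set) = {1, 2, 3, 4, 5, 6, 7}"
  using exhaust_7 by auto

text \<open>In the type \<open>7\<close> the numeral 7 equals 0, so the order of the frame is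
  carried by positions in this list and not by the index type.\<close>

lemma bij_betw_nth_7: "bij_betw ((!) [1, 2, 3, 4, 5, 6, 7 :: 7]) {..<7} UNIV"
proof -
  have "distinct [1, 2, 3, 4, 5, 6, 7 :: 7]" by simp
  moreover have "set [1, 2, 3, 4, 5, 6, 7 :: 7] = UNIV" using UNIV_7 by simp
  ultimately show ?thesis using bij_betw_nth[of "[1, 2, 3, 4, 5, 6, 7 :: 7]" "{..<7}" UNIV] by simp
qed

lemma length_frame_list: "length (frame_list e) = 7"
  by (simp add: frame_list_def)

lemma nth_frame_list: "n < 7 \<Longrightarrow> frame_list e ! n = e $ ([1, 2, 3, 4, 5, 6, 7] ! n)"
  unfolding frame_list_def by (rule nth_map) simp

lemma sum_frame_list:
  fixes Q :: "real^7 \<Rightarrow> real"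
  shows "(\<Sum>i\<in>UNIV. Q (e $ i)) = (\<Sum>n<7. Q (frame_list e ! n))"
  unfolding sum.reindex_bij_betw[OF bij_betw_nth_7, of "\<lambda>i. Q (e $ i)", symmetric]
  by (rule sum.cong) (simp_all only: nth_frame_list lessThan_iff)

definition inner_product :: "bilin \<Rightarrow> bool" where
  "inner_product h \<longleftrightarrow> bilinear h \<and> (\<forall>u v. h u v = h v u) \<and> (\<forall>u. u \<noteq> 0 \<longrightarrow> h u u > 0)"

definition frame_pos :: "7 \<Rightarrow> nat" where
  "frame_pos = inv_into {..<7} ((!) [1, 2, 3, 4, 5, 6, 7])"

lemma frame_pos_less: "frame_pos i < 7"
  using bij_betw_inv_into[OF bij_betw_nth_7] by (auto simp: frame_pos_def bij_betw_def)

lemma frame_pos_inverse: "[1, 2, 3, 4, 5, 6, 7] ! frame_pos i = i"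
  unfolding frame_pos_def by (rule bij_betw_inv_into_right[OF bij_betw_nth_7]) simp

lemma frame_pos_eq_iff: "frame_pos i = frame_pos j \<longleftrightarrow> i = j"
  by (metis frame_pos_inverse)

lemma frame_pos_ex: "n < 7 \<Longrightarrow> \<exists>i. frame_pos i = n"
  unfolding frame_pos_def using bij_betw_inv_into_left[OF bij_betw_nth_7] by (metis lessThan_iff)

lemma frame_list_frame_pos: "frame_list e ! frame_pos i = e $ i"
  by (simp add: nth_frame_list frame_pos_less frame_pos_inverse)

text \<open>Junk value \<open>0\<close> for degenerate \<open>e\<close>, where \<open>det e = 0\<close>.\<close>

definition frame_vol :: "real^7^7 \<Rightarrow> form" where
  "frame_vol e us = (if length us = 7 then det ((\<chi> i. us ! frame_pos i) :: real^7^7) / det e else 0)"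

lemma frame_vol_frame: "det e \<noteq> 0 \<Longrightarrow> frame_vol e (frame_list e) = 1"
  by (simp add: frame_vol_def length_frame_list frame_list_frame_pos)

lemma frame_vol_kform: "kform 7 (frame_vol e)"
proof (rule kformI)
  fix us ws :: "(real^7) list" assume l: "length us + length ws + 1 = 7"
  then obtain k where k: "frame_pos k = length us" using frame_pos_ex[of "length us"] by auto
  let ?c = "\<lambda>i. (us @ 0 # ws) ! frame_pos i"
  have eq: "((\<chi> i. (us @ v # ws) ! frame_pos i) :: real^7^7) = (\<chi> i. if i = k then v else ?c i)" for v
    using k by (auto simp: vec_eq_iff nth_append nth_Cons split: nat.split) (metis frame_pos_eq_iff)+
  show "linear (\<lambda>v. frame_vol e (us @ v # ws))"
  proof (rule linearI)
    show "frame_vol e (us @ (a + b) # ws) = frame_vol e (us @ a # ws) + frame_vol e (us @ b # ws)" for a b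
      using l det_row_add[of k "\<lambda>_. a" "\<lambda>_. b" ?c]
      by (simp add: frame_vol_def eq add_divide_distrib)
    show "frame_vol e (us @ (r *\<^sub>R a) # ws) = r *\<^sub>R frame_vol e (us @ a # ws)" for r a
      using l det_row_mul[of k r "\<lambda>_. a" ?c, unfolded scalar_mult_eq_scaleR]
      by (simp add: frame_vol_def eq)
  qed
next
  fix us ws zs :: "(real^7) list" and v assume l: "length us + length ws + length zs + 2 = 7"
  let ?vs = "us @ v # ws @ v # zs"
  obtain k where k: "frame_pos k = length us" using l frame_pos_ex[of "length us"] by auto
  obtain m where m: "frame_pos m = length us + length ws + 1"
    using l frame_pos_ex[of "length us + length ws + 1"] by auto
  have "k \<noteq> m" using k m by auto
  moreover have "row k ((\<chi> i. ?vs ! frame_pos i) :: real^7^7) = row m (\<chi> i. ?vs ! frame_pos i)"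
    by (simp add: row_def k m nth_append vec_eq_iff)
  ultimately have "det ((\<chi> i. ?vs ! frame_pos i) :: real^7^7) = 0"
    by (rule det_identical_rows)
  then show "frame_vol e ?vs = 0" by (simp add: frame_vol_def)
qed (simp add: frame_vol_def)

section \<open>Change of frame: expansions, traces and determinants\<close>

lemma det_invertible_expand:
  fixes e :: "real^7^7"
  assumes "det e \<noteq> 0"
  shows "\<exists>x. v = (\<Sum>i\<in>UNIV. x i *\<^sub>R e $ i)"
proof -
  obtain B where B: "B ** e = mat 1" using assms invertible_det_nz invertible_def by metis
  have "v = (v v* B) v* e" by (simp add: vector_matrix_mul_assoc B)
  also have "\<dots> = (\<Sum>i\<in>UNIV. (v v* B) $ i *\<^sub>R e $ i)"
    by (simp add: vector_matrix_mult_def vec_eq_iff sum_component mult.commute)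
  finally show ?thesis by blast
qed

lemma frame_expand:
  assumes "bilinear h" "oriented_orthonormal h e"
  shows "v = (\<Sum>i\<in>UNIV. h v (e $ i) *\<^sub>R e $ i)"
proof -
  obtain x where x: "v = (\<Sum>i\<in>UNIV. x i *\<^sub>R e $ i)"
    using det_invertible_expand[of e v] assms(2) by (auto simp: oriented_orthonormal_def)
  have lin: "linear (\<lambda>u. h u (e $ j))" for j using assms(1) by (simp add: bilinear_def)
  have on: "h (e $ i) (e $ j) = (if i = j then 1 else 0)" for i j
    using assms(2) unfolding oriented_orthonormal_def by blast
  have "h v (e $ j) = x j" for j
    unfolding x
    by (simp add: linear_sum[OF lin] linear_scale[OF lin] on mult_delta_right)
  then show ?thesis using x by simp
qed

text \<open>This is the trace of \<open>Q\<close> with respect to \<open>h\<close>. Both arguments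
  are expanded in \<open>e\<close>; summing over \<open>i\<close> first, completeness of
  \<open>f\<close> collapses the coefficients to \<open>h (e $ a) (e $ b)\<close>, a Kronecker
  delta.\<close>

lemma bilinear_frame_sum:
  fixes Q :: "real^7 \<Rightarrow> real^7 \<Rightarrow> real"
  assumes h: "inner_product h" and e: "oriented_orthonormal h e" and f: "oriented_orthonormal h f"
    and Q: "bilinear Q"
  shows "(\<Sum>i\<in>UNIV. Q (f $ i) (f $ i)) = (\<Sum>i\<in>UNIV. Q (e $ i) (e $ i))"
proof -
  have bh: "bilinear h" and sym: "h u v = h v u" for u v using h by (auto simp: inner_product_def)
  have l1: "linear (\<lambda>u. Q u v)" and l2: "linear (\<lambda>v. Q u v)" for u v using Q by (auto simp: bilinear_def)
  have lh: "linear (\<lambda>v. h u v)" for u using bh by (auto simp: bilinear_def)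
  have 1: "Q u v = (\<Sum>a\<in>UNIV. h u (e $ a) * Q (e $ a) v)" for u v
    by (subst frame_expand[OF bh e, of u]) (simp add: linear_sum[OF l1] linear_scale[OF l1])
  have 2: "Q u v = (\<Sum>b\<in>UNIV. h v (e $ b) * Q u (e $ b))" for u v
    by (subst frame_expand[OF bh e, of v]) (simp add: linear_sum[OF l2] linear_scale[OF l2])
  have "Q u v = (\<Sum>a\<in>UNIV. \<Sum>b\<in>UNIV. h u (e $ a) * h v (e $ b) * Q (e $ a) (e $ b))" for u v
  proof -
    have "Q u v = (\<Sum>a\<in>UNIV. h u (e $ a) * (\<Sum>b\<in>UNIV. h v (e $ b) * Q (e $ a) (e $ b)))"
      unfolding 1[of u v] by (rule sum.cong[OF refl], rule arg_cong[OF 2])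
    then show ?thesis by (simp add: sum_distrib_left mult.assoc)
  qed
  then have "(\<Sum>i\<in>UNIV. Q (f $ i) (f $ i)) =
    (\<Sum>i\<in>UNIV. \<Sum>a\<in>UNIV. \<Sum>b\<in>UNIV. h (f $ i) (e $ a) * h (f $ i) (e $ b) * Q (e $ a) (e $ b))"
    by (rule sum.cong[OF refl])
  also have "\<dots> = (\<Sum>a\<in>UNIV. \<Sum>b\<in>UNIV. (\<Sum>i\<in>UNIV. h (f $ i) (e $ a) * h (f $ i) (e $ b)) * Q (e $ a) (e $ b))"
    by (subst sum.swap, rule sum.cong[OF refl], subst sum.swap) (simp add: sum_distrib_right)
  also have "\<dots> = (\<Sum>a\<in>UNIV. \<Sum>b\<in>UNIV. h (e $ a) (e $ b) * Q (e $ a) (e $ b))"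
  proof -
    have "(\<Sum>i\<in>UNIV. h (f $ i) (e $ a) * h (f $ i) (e $ b)) = h (e $ a) (e $ b)" for a b
      by (subst (2) frame_expand[OF bh f, of "e $ b"])
        (simp add: linear_sum[OF lh] linear_scale[OF lh] sym mult.commute)
    then show ?thesis by simp
  qed
  also have "\<dots> = (\<Sum>a\<in>UNIV. Q (e $ a) (e $ a))"
  proof -
    have "h (e $ i) (e $ j) = (if i = j then 1 else 0)" for i j
      using e unfolding oriented_orthonormal_def by blast
    then show ?thesis by (simp add: mult_delta_left)
  qed
  finally show ?thesis .
qed

text \<open>The matrix of the change of frame is orthogonal, so its determinant is 1 or -1, and both
  frames being positive excludes -1.\<close>

lemma det_frame_eq:
  assumes h: "inner_product h" and e: "oriented_orthonormal h e" and f: "oriented_orthonormal h f"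
  shows "det f = det e"
proof -
  have bh: "bilinear h" and sym: "h u v = h v u" for u v using h by (auto simp: inner_product_def)
  have lh: "linear (\<lambda>v. h u v)" for u using bh by (auto simp: bilinear_def)
  let ?R = "(\<chi> i a. h (f $ i) (e $ a)) :: real^7^7"
  have "f = ?R ** e"
    using frame_expand[OF bh e, of "f $ _"]
    by (simp add: vec_eq_iff matrix_matrix_mult_def)
  then have d: "det f = det ?R * det e" by (metis det_mul)
  have "(\<Sum>a\<in>UNIV. h (f $ i) (e $ a) * h (f $ j) (e $ a)) = h (f $ i) (f $ j)" for i j
    by (subst (2) frame_expand[OF bh e, of "f $ j"])
      (simp add: linear_sum[OF lh] linear_scale[OF lh] sym mult.commute)
  then have "?R ** transpose ?R = mat 1"
    using f by (simp add: vec_eq_iff matrix_matrix_mult_def transpose_def mat_def oriented_orthonormal_def)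
  then have "orthogonal_matrix ?R"
    by (simp add: orthogonal_matrix_def matrix_left_right_inverse)
  then have "det ?R = 1 \<or> det ?R = -1" by (rule det_orthogonal_matrix)
  moreover have "det f > 0" "det e > 0" using e f by (auto simp: oriented_orthonormal_def)
  ultimately show ?thesis using d by auto
qed

lemma kform_frame_eqI:
  assumes "kform k \<alpha>" "kform k \<beta>" "det e \<noteq> 0"
    and "\<And>I. I \<subseteq> {..<7} \<Longrightarrow> card I = k \<Longrightarrow> \<alpha> (nths (frame_list e) I) = \<beta> (nths (frame_list e) I)"
  shows "\<alpha> = \<beta>"
proof -
  \<comment> \<open>The induction contracts with one frame vector at a time. Sets of every size are
    allowed here, so that inserting an index needs no count; sizes other than \<open>k\<close> give
    0 anyway.\<close>
  have zero: "\<gamma> = (\<lambda>_. 0)" if "kform k \<gamma>" "\<And>I. I \<subseteq> {..<7} \<Longrightarrow> \<gamma> (nths (frame_list e) I) = 0" for \<gamma>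
    using that
  proof (induction k arbitrary: \<gamma>)
    case 0
    show ?case
    proof
      show "\<gamma> vs = 0" for vs
        using 0(2)[of "{}"] kform_length[OF 0(1)] by (cases "vs = []") auto
    qed
  next
    case (Suc k)
    have *: "(frame_list e ! n) \<lrcorner> \<gamma> = (\<lambda>_. 0)" if n: "n < 7" for n
    proof (rule Suc.IH)
      show "kform k ((frame_list e ! n) \<lrcorner> \<gamma>)" by (rule interior_kform[OF Suc.prems(1)])
      fix I :: "nat set" assume I: "I \<subseteq> {..<7}"
      show "((frame_list e ! n) \<lrcorner> \<gamma>) (nths (frame_list e) I) = 0"
      proof (cases "n \<in> I")
        case True
        then show ?thesis
          using kform_nths_mem[OF Suc.prems(1)] n by (simp add: interior_def length_frame_list)
      next
        case False
        then obtain s where "\<gamma> (frame_list e ! n # nths (frame_list e) I) = s * \<gamma> (nths (frame_list e) (insert n I))"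
          using kform_nths_insert[of n "frame_list e" I] n Suc.prems(1) length_frame_list by metis
        then show ?thesis using Suc.prems(2)[of "insert n I"] I n by (simp add: interior_def)
      qed
    qed
    show ?case
    proof
      fix vs
      show "\<gamma> vs = 0"
      proof (cases vs)
        case Nil
        then show ?thesis using kform_length[OF Suc.prems(1)] by simp
      next
        case (Cons v us)
        obtain x where x: "v = (\<Sum>i\<in>UNIV. x i *\<^sub>R e $ i)"
          using det_invertible_expand[OF assms(3)] by blast
        have z: "(e $ i \<lrcorner> \<gamma>) us = 0" for i
          using *[OF frame_pos_less[of i]] by (simp add: frame_list_frame_pos)
        have "(v \<lrcorner> \<gamma>) us = 0"
          unfolding x linear_sum[OF interior_linear[OF Suc.prems(1)]]
            linear_scale[OF interior_linear[OF Suc.prems(1)]] z by simp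
        then show ?thesis using Cons by (simp add: interior_def)
      qed
    qed
  qed
  have "(\<lambda>vs. \<alpha> vs - \<beta> vs) = (\<lambda>_. 0)"
  proof (rule zero)
    show "kform k (\<lambda>vs. \<alpha> vs - \<beta> vs)" by (intro kform_diff assms)
    show "\<alpha> (nths (frame_list e) I) - \<beta> (nths (frame_list e) I) = 0" if "I \<subseteq> {..<7}" for I
      using assms(4)[OF that] kform_length[OF assms(1)] kform_length[OF assms(2)] that
      by (cases "card I = k") (auto simp: length_nths_Pow length_frame_list)
  qed
  then show ?thesis by (auto simp: fun_eq_iff)
qed

text \<open>The criterion in computable form: unfolding \<open>splits\<close> leaves 35 equations
  for \<open>k = 3\<close> or \<open>k = 4\<close>, and 21 for \<open>k = 2\<close>.\<close>

lemma kform_eqI: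
  assumes "kform k \<alpha>" "kform k \<beta>" "det e \<noteq> 0"
    and "\<forall>(s, a, b)\<in>set (splits k (frame_list e)). \<alpha> a = \<beta> a"
  shows "\<alpha> = \<beta>"
proof (rule kform_frame_eqI[OF assms(1-3)])
  fix I :: "nat set" assume "I \<subseteq> {..<7}" "card I = k"
  then have "(shuffle_sign 7 I, nths (frame_list e) I, nths (frame_list e) (- I)) \<in> set (splits k (frame_list e))"
    by (auto simp: set_splits length_frame_list)
  then show "\<alpha> (nths (frame_list e) I) = \<beta> (nths (frame_list e) I)" using assms(4) by auto
qed

section \<open>The inner product of forms in a given frame\<close>

definition frame_inner :: "real^7^7 \<Rightarrow> form \<Rightarrow> form \<Rightarrow> real" where
  "frame_inner f \<alpha> \<beta> = (\<Sum>I\<in>Pow {..<7}. \<alpha> (nths (frame_list f) I) * \<beta> (nths (frame_list f) I))"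

text \<open>Contracting with the \<open>n\<close>-th vector matches the sets without
  \<open>n\<close> with those containing it; the reordering sign occurs twice and
  disappears.\<close>

lemma frame_inner_interior:
  assumes "kform k \<alpha>" "kform l \<beta>" "n < 7"
  shows "frame_inner f (frame_list f ! n \<lrcorner> \<alpha>) (frame_list f ! n \<lrcorner> \<beta>) =
    (\<Sum>I\<in>Pow {..<7}. if n \<in> I then \<alpha> (nths (frame_list f) I) * \<beta> (nths (frame_list f) I) else 0)"
proof -
  let ?a = "\<lambda>I. \<alpha> (nths (frame_list f) I) * \<beta> (nths (frame_list f) I)"
  have 1: "\<alpha> (frame_list f ! n # nths (frame_list f) J) * \<beta> (frame_list f ! n # nths (frame_list f) J) =
      (if n \<notin> J then ?a (insert n J) else 0)" for J
  proof (cases "n \<in> J")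
    case True
    then show ?thesis using kform_nths_mem[OF assms(1), of n] assms(3) by (simp add: length_frame_list)
  next
    case False
    obtain s :: real where s: "s \<in> {1, -1}" "\<And>k \<gamma>. kform k \<gamma> \<Longrightarrow>
        \<gamma> (frame_list f ! n # nths (frame_list f) J) = s * \<gamma> (nths (frame_list f) (insert n J))"
      using kform_nths_insert[of n "frame_list f" J] False assms(3)
      unfolding length_frame_list by blast
    have s2: "(s * x) * (s * y) = x * y" for x y :: real using s(1) by auto
    then show ?thesis using False s(2)[OF assms(1)] s(2)[OF assms(2)]
      by (simp add: s2)
  qed
  have "(\<Sum>J\<in>Pow {..<7}. if n \<notin> J then ?a (insert n J) else 0) = (\<Sum>J\<in>{J \<in> Pow {..<7}. n \<notin> J}. ?a (insert n J))"
    by (rule sum.inter_filter[symmetric]) simp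
  also have "\<dots> = (\<Sum>I\<in>{I \<in> Pow {..<7}. n \<in> I}. ?a I)"
    by (rule sum.reindex_bij_witness[of _ "\<lambda>I. I - {n}" "insert n"]) (use assms(3) in auto)
  also have "\<dots> = (\<Sum>I\<in>Pow {..<7}. if n \<in> I then ?a I else 0)"
    by (rule sum.inter_filter) simp
  finally show ?thesis by (simp add: frame_inner_def interior_def 1)
qed

text \<open>Each \<open>k + 1\<close>-subset arises from \<open>k + 1\<close> choices of the index \<open>i\<close>. This reduces the
  independence of the frame to the contraction of a bilinear map, by induction on the degree.\<close>

lemma frame_inner_Suc:
  assumes "kform (Suc k) \<alpha>" "kform (Suc k) \<beta>"
  shows "(\<Sum>i\<in>UNIV. frame_inner f (f $ i \<lrcorner> \<alpha>) (f $ i \<lrcorner> \<beta>)) = real (Suc k) * frame_inner f \<alpha> \<beta>"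
proof -
  let ?a = "\<lambda>I. \<alpha> (nths (frame_list f) I) * \<beta> (nths (frame_list f) I)"
  have "(\<Sum>i\<in>UNIV. frame_inner f (f $ i \<lrcorner> \<alpha>) (f $ i \<lrcorner> \<beta>)) =
      (\<Sum>n<7. \<Sum>I\<in>Pow {..<7}. if n \<in> I then ?a I else 0)"
    by (subst sum_frame_list[of "\<lambda>v. frame_inner f (v \<lrcorner> \<alpha>) (v \<lrcorner> \<beta>)"])
      (simp add: frame_inner_interior[OF assms])
  also have "\<dots> = (\<Sum>I\<in>Pow {..<7}. \<Sum>n<7. if n \<in> I then ?a I else 0)"
    by (rule sum.swap)
  also have "\<dots> = (\<Sum>I\<in>Pow {..<7}. real (Suc k) * ?a I)"
  proof (rule sum.cong[OF refl])
    fix I :: "nat set" assume I: "I \<in> Pow {..<7}"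
    have "(\<Sum>n<7. if n \<in> I then ?a I else 0) = (\<Sum>n\<in>{n \<in> {..<7}. n \<in> I}. ?a I)"
      by (rule sum.inter_filter[symmetric]) simp
    also have "{n \<in> {..<7}. n \<in> I} = I" using I by auto
    also have "(\<Sum>n\<in>I. ?a I) = real (Suc k) * ?a I"
      using I kform_length[OF assms(1), of "nths (frame_list f) I"]
      by (cases "card I = Suc k") (auto simp: length_nths_Pow length_frame_list)
    finally show "(\<Sum>n<7. if n \<in> I then ?a I else 0) = real (Suc k) * ?a I" .
  qed
  finally show ?thesis by (simp only: frame_inner_def sum_distrib_left)
qed

lemma linear_sum_mult:
  fixes A :: "'i \<Rightarrow> 'a::real_vector \<Rightarrow> real"
  assumes "\<And>i. linear (A i)"
  shows "linear (\<lambda>v. \<Sum>i\<in>S. A i v * c i)"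
  by (intro linearI)
    (simp_all add: linear_add[OF assms] linear_scale[OF assms] sum.distrib distrib_right
      sum_distrib_left mult.assoc)

lemma frame_inner_interior_bilinear:
  assumes "kform k \<alpha>" "kform l \<beta>"
  shows "bilinear (\<lambda>x y. frame_inner e (x \<lrcorner> \<alpha>) (y \<lrcorner> \<beta>))"
  unfolding bilinear_def frame_inner_def
proof (intro conjI allI)
  let ?I = "\<lambda>I. nths (frame_list e) I"
  show "linear (\<lambda>x. \<Sum>I\<in>Pow {..<7}. (x \<lrcorner> \<alpha>) (?I I) * (y \<lrcorner> \<beta>) (?I I))" for y
    by (rule linear_sum_mult[OF interior_linear[OF assms(1)]])
  show "linear (\<lambda>y. \<Sum>I\<in>Pow {..<7}. (x \<lrcorner> \<alpha>) (?I I) * (y \<lrcorner> \<beta>) (?I I))" for x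
    using linear_sum_mult[OF interior_linear[OF assms(2)], where c = "\<lambda>I. (x \<lrcorner> \<alpha>) (?I I)"]
    by (simp add: mult.commute)
qed

lemma frame_inner_indep:
  assumes h: "inner_product h" "oriented_orthonormal h e" "oriented_orthonormal h f"
    and "kform k \<alpha>" "kform k \<beta>"
  shows "frame_inner f \<alpha> \<beta> = frame_inner e \<alpha> \<beta>"
  using assms(4,5)
proof (induction k arbitrary: \<alpha> \<beta>)
  case 0
  have "frame_inner f \<alpha> \<beta> = (\<Sum>I\<in>{{}}. \<alpha> (nths (frame_list f) I) * \<beta> (nths (frame_list f) I))" for f
    unfolding frame_inner_def
  proof (rule sum.mono_neutral_right)
    show "\<forall>I\<in>Pow {..<7} - {{}}. \<alpha> (nths (frame_list f) I) * \<beta> (nths (frame_list f) I) = 0"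
    proof
      fix I :: "nat set" assume I: "I \<in> Pow {..<7} - {{}}"
      then have "card I \<noteq> 0" using finite_subset[of I "{..<7}"] by auto
      then have "length (nths (frame_list f) I) \<noteq> 0"
        using I length_nths_Pow[of I "frame_list f"] by (simp add: length_frame_list)
      then show "\<alpha> (nths (frame_list f) I) * \<beta> (nths (frame_list f) I) = 0"
        using kform_length[OF 0(1)] by simp
    qed
  qed auto
  then show ?case by simp
next
  case (Suc k)
  have "real (Suc k) * frame_inner f \<alpha> \<beta> = (\<Sum>i\<in>UNIV. frame_inner f (f $ i \<lrcorner> \<alpha>) (f $ i \<lrcorner> \<beta>))"
    using frame_inner_Suc[OF Suc.prems] by simp
  \<comment> \<open>The frame is changed in two stages: first inside, where the forms have degree
    \<open>k\<close>, then in the contraction, which is a trace.\<close>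
  also have "\<dots> = (\<Sum>i\<in>UNIV. frame_inner e (f $ i \<lrcorner> \<alpha>) (f $ i \<lrcorner> \<beta>))"
    by (intro sum.cong refl Suc.IH interior_kform Suc.prems)
  also have "\<dots> = (\<Sum>i\<in>UNIV. frame_inner e (e $ i \<lrcorner> \<alpha>) (e $ i \<lrcorner> \<beta>))"
    by (rule bilinear_frame_sum[OF h frame_inner_interior_bilinear[OF Suc.prems]])
  also have "\<dots> = real (Suc k) * frame_inner e \<alpha> \<beta>"
    using frame_inner_Suc[OF Suc.prems] by simp
  finally show ?case by simp
qed

section \<open>Basis forms, the volume form and the Hodge star\<close>

lemma flat_wedge_Cons:
  assumes "bilinear h"
  shows "(flat h v \<and>\<^sub>w \<beta>) (u # vs) = h v u * \<beta> vs - (flat h v \<and>\<^sub>w (u \<lrcorner> \<beta>)) vs"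
proof -
  have "kform 0 (u \<lrcorner> flat h v)"
    using interior_kform[of 0 "flat h v" u] flat_kform[OF assms] by simp
  then show ?thesis
    by (simp add: wedge_Cons[OF flat_kform[OF assms]] wedge_splits[of 0 "u \<lrcorner> _"]) (simp add: interior_def flat_def)
qed

text \<open>The product in \<open>basis_form\<close>, but for an arbitrary list of vectors, which
  permits induction on the list.\<close>

definition flat_wedge :: "bilin \<Rightarrow> (real^7) list \<Rightarrow> form" where
  "flat_wedge h us = foldr (\<lambda>v \<alpha>. flat h v \<and>\<^sub>w \<alpha>) us unit_form"

lemma flat_wedge_simps:
  "flat_wedge h [] = unit_form"
  "flat_wedge h (u # us) = flat h u \<and>\<^sub>w flat_wedge h us"
  by (simp_all add: flat_wedge_def)

lemma flat_wedge_kform: "bilinear h \<Longrightarrow> kform (length us) (flat_wedge h us)"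
proof (induction us)
  case Nil
  then show ?case by (auto simp: flat_wedge_simps unit_form_def intro!: kformI split: if_splits)
next
  case (Cons u us)
  then show ?case using wedge_kform[OF flat_kform Cons.IH, of h u] by (simp add: flat_wedge_simps)
qed

lemma interior_flat_wedge_orthogonal:
  assumes "bilinear h"
  shows "\<forall>u\<in>set us. h u v = 0 \<Longrightarrow> v \<lrcorner> flat_wedge h us = (\<lambda>_. 0)"
proof (induction us)
  case Nil
  then show ?case by (auto simp: flat_wedge_simps interior_def unit_form_def)
next
  case (Cons u us)
  then show ?case
    by (auto simp: flat_wedge_simps interior_def[of v "flat h u \<and>\<^sub>w _"] flat_wedge_Cons[OF assms] wedge_zero_right)
qed

lemma flat_wedge_orthogonal:
  assumes "bilinear h" "v \<in> set vs" "\<forall>u\<in>set us. h u v = 0"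
  shows "flat_wedge h us vs = 0"
proof -
  obtain A B where "vs = A @ v # B" using assms(2) by (meson split_list)
  moreover have "flat_wedge h us (v # A @ B) = 0"
    using interior_flat_wedge_orthogonal[OF assms(1,3)] by (auto simp: interior_def fun_eq_iff)
  ultimately show ?thesis
    using kform_move[OF flat_wedge_kform[OF assms(1)], of us "[]" v A B] by simp
qed

lemma flat_wedge_self:
  assumes "bilinear h" "distinct us" "\<forall>u\<in>set us. \<forall>v\<in>set us. h u v = (if u = v then 1 else 0)"
  shows "flat_wedge h us us = 1"
  using assms(2,3)
proof (induction us)
  case Nil
  then show ?case by (simp add: flat_wedge_simps unit_form_def)
next
  case (Cons u us)
  have "\<forall>v\<in>set us. h v u = 0" using Cons.prems by auto
  then show ?case
    using Cons interior_flat_wedge_orthogonal[OF assms(1)]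
    by (auto simp: flat_wedge_simps flat_wedge_Cons[OF assms(1)] wedge_zero_right)
qed

lemma frame_list_orthonormal:
  assumes "oriented_orthonormal h e" "m < 7" "n < 7"
  shows "h (frame_list e ! m) (frame_list e ! n) = (if m = n then 1 else 0)"
proof -
  obtain i j where "m = frame_pos i" "n = frame_pos j" using frame_pos_ex assms(2,3) by metis
  then show ?thesis using assms(1)
    unfolding oriented_orthonormal_def by (simp add: frame_list_frame_pos frame_pos_eq_iff)
qed

lemma distinct_frame_list:
  assumes "oriented_orthonormal h e"
  shows "distinct (frame_list e)"
  unfolding distinct_conv_nth length_frame_list
  using frame_list_orthonormal[OF assms] by (metis zero_neq_one)

lemma basis_form_frame:
  assumes "bilinear h" "oriented_orthonormal h e" "I \<subseteq> {..<7}" "J \<subseteq> {..<7}" "card I = card J"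
  shows "basis_form h e I (nths (frame_list e) J) = (if I = J then 1 else 0)"
proof (cases "I = J")
  case True
  have "h u v = (if u = v then 1 else 0)" if "u \<in> set (frame_list e)" "v \<in> set (frame_list e)" for u v
    using that frame_list_orthonormal[OF assms(2)] distinct_frame_list[OF assms(2)]
    by (auto simp: in_set_conv_nth length_frame_list nth_eq_iff_index_eq)
  then show ?thesis
    using True flat_wedge_self[OF assms(1), of "nths (frame_list e) I"] distinct_frame_list[OF assms(2)]
    by (auto simp: basis_form_def flat_wedge_def dest!: in_set_nthsD intro: distinct_nthsI)
next
  case False
  \<comment> \<open>By equal cardinality \<open>J\<close> has an index outside \<open>I\<close>; its
    frame vector is orthogonal to every factor of the product.\<close>
  have "\<not> J \<subseteq> I" using False assms(3-5) by (metis card_subset_eq finite_lessThan finite_subset)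
  then obtain j where j: "j \<in> J" "j \<notin> I" by blast
  have "frame_list e ! j \<in> set (nths (frame_list e) J)"
    using j assms(4) by (auto simp: set_nths length_frame_list)
  moreover have "\<forall>u\<in>set (nths (frame_list e) I). h u (frame_list e ! j) = 0"
    using j assms(3,4) frame_list_orthonormal[OF assms(2)] by (auto simp: set_nths length_frame_list)
  ultimately show ?thesis
    using False flat_wedge_orthogonal[OF assms(1)] by (simp add: basis_form_def flat_wedge_def)
qed

lemma basis_form_kform:
  assumes "bilinear h" "I \<subseteq> {..<7}"
  shows "kform (card I) (basis_form h e I)"
  using flat_wedge_kform[OF assms(1), of "nths (frame_list e) I"] assms(2)
  by (simp add: basis_form_def flat_wedge_def length_nths_Pow length_frame_list)

lemma card_compl_7: "I \<subseteq> {..<7::nat} \<Longrightarrow> card ({..<7} - I) = 7 - card I"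
  by (simp add: card_Diff_subset finite_subset)

text \<open>The summands in the definition of the star are contractions of the volume form, and its
  dependence on the frame is settled by a determinant.\<close>

lemma frame_vol_append:
  assumes "bilinear h" "oriented_orthonormal h e" "I \<subseteq> {..<7}"
  shows "frame_vol e (nths (frame_list e) I @ vs) = shuffle_sign 7 I * basis_form h e ({..<7} - I) vs"
proof -
  let ?xs = "frame_list e"
  have d: "det e \<noteq> 0" using assms(2) by (simp add: oriented_orthonormal_def)
  have c: "card I \<le> 7" using assms(3) card_mono[of "{..<7::nat}"] by force
  have compl: "nths ?xs (- I) = nths ?xs ({..<7} - I)"
    by (rule nths_cong) (simp add: length_frame_list)
  have "(\<lambda>vs. frame_vol e (nths ?xs I @ vs)) = (\<lambda>vs. shuffle_sign 7 I * basis_form h e ({..<7} - I) vs)"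
  proof (rule kform_frame_eqI[OF _ _ d])
    show "kform (7 - card I) (\<lambda>vs. frame_vol e (nths ?xs I @ vs))"
      using c assms(3) by (intro kform_append_left) (simp add: frame_vol_kform length_nths_Pow length_frame_list)
    show "kform (7 - card I) (\<lambda>vs. shuffle_sign 7 I * basis_form h e ({..<7} - I) vs)"
      using basis_form_kform[OF assms(1), of "{..<7} - I" e] assms(3)
      by (intro kform_scale) (simp add: card_compl_7)
    fix J :: "nat set" assume J: "J \<subseteq> {..<7}" "card J = 7 - card I"
    show "frame_vol e (nths ?xs I @ nths ?xs J) = shuffle_sign 7 I * basis_form h e ({..<7} - I) (nths ?xs J)"
    proof (cases "J = {..<7} - I")
      case True
      have "frame_vol e (nths ?xs I @ nths ?xs (- I)) = shuffle_sign 7 I"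
        using kform_shuffle[OF frame_vol_kform, of I ?xs e "[]"] assms(3) frame_vol_frame[OF d]
        by (simp add: length_frame_list)
      moreover have "basis_form h e ({..<7} - I) (nths ?xs ({..<7} - I)) = 1"
        using basis_form_frame[OF assms(1,2), of "{..<7} - I" "{..<7} - I"] by simp
      ultimately show ?thesis by (simp add: True compl)
    next
      case False
      have "basis_form h e ({..<7} - I) (nths ?xs J) = 0"
        using basis_form_frame[OF assms(1,2), of "{..<7} - I" J] J False assms(3)
        by (auto simp: card_compl_7)
      \<comment> \<open>\<open>J\<close> meets \<open>I\<close>, so the volume form receives some
        frame vector twice.\<close>
      moreover have "\<not> J \<subseteq> {..<7} - I"
        using False J assms(3) by (metis card_compl_7 card_subset_eq finite_Diff finite_lessThan)
      then obtain j where j: "j \<in> J" "j \<in> I" "j < 7" using J by auto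
      then have "?xs ! j \<in> set (nths ?xs I)" "?xs ! j \<in> set (nths ?xs J)"
        by (auto simp: set_nths length_frame_list)
      then obtain A A' B B' where "nths ?xs I = A @ ?xs ! j # A'" "nths ?xs J = B @ ?xs ! j # B'"
        by (meson split_list)
      then have "frame_vol e (nths ?xs I @ nths ?xs J) = 0"
        using kform_repeat[OF frame_vol_kform, of e A "?xs ! j" "A' @ B" B'] by simp
      ultimately show ?thesis by simp
    qed
  qed
  then show ?thesis by (rule fun_cong)
qed

lemma frame_vol_indep:
  assumes "inner_product h" "oriented_orthonormal h e" "oriented_orthonormal h f"
  shows "frame_vol f = frame_vol e"
  using det_frame_eq[OF assms] by (simp add: frame_vol_def fun_eq_iff)

lemma on_frame: "oriented_orthonormal h e \<Longrightarrow> oriented_orthonormal h (on_frame h)"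
  unfolding on_frame_def by (rule someI)

lemma form_inner_frame:
  assumes "inner_product h" "oriented_orthonormal h e" "kform k \<alpha>" "kform k \<beta>"
  shows "form_inner h \<alpha> \<beta> = frame_inner e \<alpha> \<beta>"
  using frame_inner_indep[OF assms(1,2) on_frame[OF assms(2)] assms(3,4)]
  by (simp add: form_inner_def frame_inner_def)

text \<open>The star of \<alpha> at \<open>vs\<close> is the inner product of \<alpha> with vol(-,
  vs). The length condition makes the latter a \<open>k\<close>-form, so that
  \<open>frame_inner_indep\<close> applies.\<close>

lemma hodge_frame:
  assumes "inner_product h" "oriented_orthonormal h e" "kform k \<alpha>" "length vs + k = 7"
  shows "hodge h \<alpha> vs = frame_inner e \<alpha> (\<lambda>us. frame_vol e (us @ vs))"
proof -
  have bh: "bilinear h" using assms(1) by (simp add: inner_product_def)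
  note f = on_frame[OF assms(2)]
  have "hodge h \<alpha> vs = frame_inner (on_frame h) \<alpha> (\<lambda>us. frame_vol (on_frame h) (us @ vs))"
    unfolding hodge_def frame_inner_def
    by (rule sum.cong) (simp_all add: frame_vol_append[OF bh f])
  also have "\<dots> = frame_inner e \<alpha> (\<lambda>us. frame_vol (on_frame h) (us @ vs))"
    by (rule frame_inner_indep[OF assms(1,2) f assms(3)], rule kform_append_right)
      (use assms(4) in \<open>simp add: frame_vol_kform add.commute\<close>)
  finally show ?thesis by (simp add: frame_vol_indep[OF assms(1,2) f])
qed

lemma hodge_kform:
  assumes "bilinear h" "kform k \<alpha>" "k + l = 7"
  shows "kform l (hodge h \<alpha>)"
proof -
  have "kform l (\<lambda>vs. \<alpha> (nths (frame_list (on_frame h)) I) *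
      shuffle_sign 7 I * basis_form h (on_frame h) ({..<7} - I) vs)" if "I \<in> Pow {..<7}" for I
  proof (cases "card I = k")
    case True
    then have "card ({..<7} - I) = l" using that assms(3) by (auto simp: card_compl_7)
    then show ?thesis using basis_form_kform[OF assms(1), of "{..<7} - I"] by (intro kform_scale) auto
  next
    case False
    then show ?thesis
      using kform_length[OF assms(2)] that by (simp add: length_nths_Pow length_frame_list kform_zero)
  qed
  then show ?thesis unfolding hodge_def[abs_def] by (rule kform_sum)
qed

text \<open>Used as a rewrite rule for the star in any oriented orthonormal frame. In the sum over
  index sets only the one complementary to \<open>b\<close> survives.\<close>

lemma hodge_at_frame:
  assumes "inner_product h" "oriented_orthonormal h e" "kform k \<alpha>"
  shows "\<forall>(s, a, b)\<in>set (splits k (frame_list e)). hodge h \<alpha> b = s * \<alpha> a"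
proof clarify
  fix s a b assume "(s, a, b) \<in> set (splits k (frame_list e))"
  then obtain I where I: "I \<subseteq> {..<7}" "card I = k" "s = shuffle_sign 7 I"
      "a = nths (frame_list e) I" "b = nths (frame_list e) (- I)"
    by (auto simp: set_splits length_frame_list)
  have bh: "bilinear h" using assms(1) by (simp add: inner_product_def)
  have "card I \<le> 7" using I card_mono[of "{..<7::nat}"] by force
  have compl: "b = nths (frame_list e) ({..<7} - I)"
    unfolding I(5) by (rule nths_cong) (simp add: length_frame_list)
  have len: "length b + k = 7"
    using I(1,2) \<open>card I \<le> 7\<close> by (simp add: compl length_nths_Pow length_frame_list card_compl_7)
  have "hodge h \<alpha> b = (\<Sum>J\<in>Pow {..<7}. \<alpha> (nths (frame_list e) J) *
      (shuffle_sign 7 J * basis_form h e ({..<7} - J) b))"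
    unfolding hodge_frame[OF assms len] frame_inner_def
    by (rule sum.cong) (simp_all add: frame_vol_append[OF bh assms(2)])
  also have "\<dots> = (\<Sum>J\<in>Pow {..<7}. if J = I then s * \<alpha> a else 0)"
  proof (rule sum.cong[OF refl])
    fix J :: "nat set" assume J: "J \<in> Pow {..<7}"
    show "\<alpha> (nths (frame_list e) J) * (shuffle_sign 7 J * basis_form h e ({..<7} - J) b) =
      (if J = I then s * \<alpha> a else 0)"
    proof (cases "card J = k")
      case True
      then have "basis_form h e ({..<7} - J) b = (if {..<7} - J = {..<7} - I then 1 else 0)"
        unfolding compl using J I by (intro basis_form_frame[OF bh assms(2)]) (auto simp: card_compl_7)
      moreover have "{..<7} - J = {..<7} - I \<longleftrightarrow> J = I" using J I(1) by blast
      ultimately show ?thesis using I by simp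
    next
      case False
      then show ?thesis
        using J I(2) kform_length[OF assms(3)] by (auto simp: length_nths_Pow length_frame_list)
    qed
  qed
  also have "\<dots> = s * \<alpha> a" using I(1) by simp
  finally show "hodge h \<alpha> b = s * \<alpha> a" .
qed

lemma frame_inner_splits:
  assumes "kform k \<alpha>"
  shows "frame_inner e \<alpha> \<beta> = (\<Sum>(s, a, b)\<leftarrow>splits k (frame_list e). \<alpha> a * \<beta> a)"
  unfolding sum_Pow_eq_splits[symmetric] frame_inner_def
  by (rule sum.cong) (auto simp: kform_length[OF assms] length_nths_Pow length_frame_list)

section \<open>The standard form in an adapted frame\<close>

lemma sum_less_7: "(\<Sum>m<7. f m) = f 0 + f 1 + f 2 + f 3 + f 4 + f 5 + f (6::nat)"
  by (simp add: eval_nat_numeral lessThan_Suc add.commute add.left_commute)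

lemma all_less_7: "(\<forall>m<7::nat. P m) \<longleftrightarrow> P 0 \<and> P 1 \<and> P 2 \<and> P 3 \<and> P 4 \<and> P 5 \<and> P 6"
  by (simp add: eval_nat_numeral All_less_Suc conj_ac)

lemma splits_numeral:
  "splits 1 xs = splits (Suc 0) xs"
  "splits 2 xs = splits (Suc (Suc 0)) xs"
  "splits 3 xs = splits (Suc (Suc (Suc 0))) xs"
  "splits 4 xs = splits (Suc (Suc (Suc (Suc 0)))) xs"
  by (simp_all add: eval_nat_numeral)

lemmas splits_simps = splits_numeral splits.simps

lemma e3_eval:
  assumes "bilinear h"
  shows "e3 h e i j k [x, y, z] =
    h (e $ i) x * (h (e $ j) y * h (e $ k) z - h (e $ j) z * h (e $ k) y)
    - h (e $ i) y * (h (e $ j) x * h (e $ k) z - h (e $ j) z * h (e $ k) x)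
    + h (e $ i) z * (h (e $ j) x * h (e $ k) y - h (e $ j) y * h (e $ k) x)"
  by (simp add: e3_def wedge_splits[OF flat_kform[OF assms]] splits_simps flat_def algebra_simps)

lemma e3_kform: "bilinear h \<Longrightarrow> kform 3 (e3 h e i j k)"
  using wedge_kform[OF flat_kform wedge_kform[OF flat_kform flat_kform], of h h h "e $ i" "e $ j" "e $ k"]
  by (simp add: e3_def numeral_3_eq_3)

text \<open>The linear algebra of one tangent space. The frame \<open>e\<close> need not be
  \<open>on_frame h\<close>.\<close>

locale adapted_frame =
  fixes h :: bilin and e :: "real^7^7" and w :: form
  assumes inner: "inner_product h"
    and frame: "oriented_orthonormal h e"
    and w_eq: "w = standard_G2_form h e"
begin

definition E :: "nat \<Rightarrow> real^7" where
  "E n = frame_list e ! n"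

lemma bilin: "bilinear h"
  using inner by (simp add: inner_product_def)

lemma det_frame: "det e \<noteq> 0"
  using frame by (simp add: oriented_orthonormal_def)

lemma frame_list_E: "frame_list e = [E 0, E 1, E 2, E 3, E 4, E 5, E 6]"
  by (simp add: E_def frame_list_def)

lemma frame_E: "e $ 1 = E 0" "e $ 2 = E 1" "e $ 3 = E 2" "e $ 4 = E 3" "e $ 5 = E 4" "e $ 6 = E 5" "e $ 7 = E 6"
  by (simp_all add: E_def frame_list_def)

lemma h_E: "m < 7 \<Longrightarrow> n < 7 \<Longrightarrow> h (E m) (E n) = (if m = n then 1 else 0)"
  unfolding E_def by (rule frame_list_orthonormal[OF frame])

lemma w_kform: "kform 3 w"
  unfolding w_eq standard_G2_form_def[abs_def]
  by (intro kform_add kform_diff e3_kform bilin)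

text \<open>The guards \<open>j < i\<close> and \<open>k < j\<close> turn these into terminating
  rewrite rules that sort numeral indices.\<close>

lemma kform_3_swap:
  assumes "kform 3 \<alpha>"
  shows "j < i \<Longrightarrow> \<alpha> [E i, E j, E k] = - \<alpha> [E j, E i, E k]"
    "k < j \<Longrightarrow> \<alpha> [E i, E j, E k] = - \<alpha> [E i, E k, E j]"
    "\<alpha> [E i, E i, E k] = 0"
    "\<alpha> [E i, E j, E j] = 0"
  by (rule kform_swap[OF assms, of "[]" "E i" "E j" "[E k]", unfolded append.simps]
      kform_swap[OF assms, of "[E i]" "E j" "E k" "[]", unfolded append.simps]
      kform_repeat[OF assms, of "[]" "E i" "[]" "[E k]", unfolded append.simps]
      kform_repeat[OF assms, of "[E i]" "E j" "[]" "[]", unfolded append.simps])+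

lemma kform_4_swap:
  assumes "kform 4 \<alpha>"
  shows "j < i \<Longrightarrow> \<alpha> [E i, E j, E k, E l] = - \<alpha> [E j, E i, E k, E l]"
    "k < j \<Longrightarrow> \<alpha> [E i, E j, E k, E l] = - \<alpha> [E i, E k, E j, E l]"
    "l < k \<Longrightarrow> \<alpha> [E i, E j, E k, E l] = - \<alpha> [E i, E j, E l, E k]"
    "\<alpha> [E i, E i, E k, E l] = 0"
    "\<alpha> [E i, E j, E j, E l] = 0"
    "\<alpha> [E i, E j, E k, E k] = 0"
  by (rule kform_swap[OF assms, of "[]" "E i" "E j" "[E k, E l]", unfolded append.simps]
      kform_swap[OF assms, of "[E i]" "E j" "E k" "[E l]", unfolded append.simps]
      kform_swap[OF assms, of "[E i, E j]" "E k" "E l" "[]", unfolded append.simps]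
      kform_repeat[OF assms, of "[]" "E i" "[]" "[E k, E l]", unfolded append.simps]
      kform_repeat[OF assms, of "[E i]" "E j" "[]" "[E l]", unfolded append.simps]
      kform_repeat[OF assms, of "[E i, E j]" "E k" "[]" "[]", unfolded append.simps])+

lemma w_values:
  "\<forall>i<7. \<forall>j<7. \<forall>k<7. i < j \<and> j < k \<longrightarrow> w [E i, E j, E k] =
    (if (i, j, k) \<in> {(0, 1, 6), (0, 2, 4), (2, 3, 6), (4, 5, 6)} then 1
     else if (i, j, k) \<in> {(0, 3, 5), (1, 2, 5), (1, 3, 4)} then -1 else 0)"
proof -
  have "\<forall>m<7. \<forall>n<7. h (E m) (E n) = (if m = n then 1 else 0)" using h_E by blast
  note h_table = this[unfolded all_less_7, simplified]
  show ?thesis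
    unfolding all_less_7
    by (simp add: w_eq standard_G2_form_def e3_eval[OF bilin] frame_E h_table)
qed

lemma w_sorted:
  "i < j \<Longrightarrow> j < k \<Longrightarrow> k < 7 \<Longrightarrow> w [E i, E j, E k] =
    (if (i, j, k) \<in> {(0, 1, 6), (0, 2, 4), (2, 3, 6), (4, 5, 6)} then 1
     else if (i, j, k) \<in> {(0, 3, 5), (1, 2, 5), (1, 3, 4)} then -1 else 0)"
  using w_values by (meson order_less_trans)

lemmas w_eval = w_sorted kform_3_swap[OF w_kform]

lemma hodge_w_kform: "kform 4 (hodge h w)"
  by (rule hodge_kform[OF bilin w_kform]) simp

lemmas hodge_3 = hodge_at_frame[OF inner frame, where k = 3, unfolded frame_list_E]
lemmas hodge_4 = hodge_at_frame[OF inner frame, where k = 4, unfolded frame_list_E]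

text \<open>The quadruples are the complements of the seven triples of \<open>w\<close>: 1-based, *w
  = e_1234 + e_1256 + e_1367 + e_1457 + e_2357 - e_2467 + e_3456.\<close>

lemma hodge_w_values:
  "\<forall>i<7. \<forall>j<7. \<forall>k<7. \<forall>l<7. i < j \<and> j < k \<and> k < l \<longrightarrow> hodge h w [E i, E j, E k, E l] =
    (if (i, j, k, l) \<in> {(0, 1, 2, 3), (0, 1, 4, 5), (0, 2, 5, 6), (0, 3, 4, 6), (1, 2, 4, 6), (2, 3, 4, 5)} then 1
     else if (i, j, k, l) = (1, 3, 5, 6) then -1 else 0)"
proof -
  note * = hodge_3[OF w_kform, simplified splits_simps, simplified, simplified w_eval, simplified]
  show ?thesis unfolding all_less_7 by (simp add: *)
qed

lemma hodge_w_sorted: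
  "i < j \<Longrightarrow> j < k \<Longrightarrow> k < l \<Longrightarrow> l < 7 \<Longrightarrow> hodge h w [E i, E j, E k, E l] =
    (if (i, j, k, l) \<in> {(0, 1, 2, 3), (0, 1, 4, 5), (0, 2, 5, 6), (0, 3, 4, 6), (1, 2, 4, 6), (2, 3, 4, 5)} then 1
     else if (i, j, k, l) = (1, 3, 5, 6) then -1 else 0)"
  using hodge_w_values by (meson order_less_trans)

lemmas hodge_w_eval = hodge_w_sorted kform_4_swap[OF hodge_w_kform]

text \<open>Each index lies in three of the seven triples, hence six ordered pairs. \<open>f\<close>
  is left general, to be a matrix or the components of a 2-form.\<close>

lemma sum_w:
  fixes f :: "nat \<Rightarrow> nat \<Rightarrow> real"
  shows "(\<Sum>p<7. \<Sum>q<7. f p q * w [E 0, E p, E q]) = f 1 6 + f 2 4 - f 3 5 - f 4 2 + f 5 3 - f 6 1"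
    "(\<Sum>p<7. \<Sum>q<7. f p q * w [E 1, E p, E q]) = -f 0 6 - f 2 5 - f 3 4 + f 4 3 + f 5 2 + f 6 0"
    "(\<Sum>p<7. \<Sum>q<7. f p q * w [E 2, E p, E q]) = -f 0 4 + f 1 5 + f 3 6 + f 4 0 - f 5 1 - f 6 3"
    "(\<Sum>p<7. \<Sum>q<7. f p q * w [E 3, E p, E q]) = f 0 5 + f 1 4 - f 2 6 - f 4 1 - f 5 0 + f 6 2"
    "(\<Sum>p<7. \<Sum>q<7. f p q * w [E 4, E p, E q]) = f 0 2 - f 1 3 - f 2 0 + f 3 1 + f 5 6 - f 6 5"
    "(\<Sum>p<7. \<Sum>q<7. f p q * w [E 5, E p, E q]) = -f 0 3 - f 1 2 + f 2 1 + f 3 0 - f 4 6 + f 6 4"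
    "(\<Sum>p<7. \<Sum>q<7. f p q * w [E 6, E p, E q]) = f 0 1 - f 1 0 + f 2 3 - f 3 2 + f 4 5 - f 5 4"
  unfolding sum_less_7 One_nat_def by (simp_all add: w_eval)

text \<open>
  The matrix \<open>m\<close> acts on \<open>w\<close> as a derivation. That \<open>m\<close> is skew reflects that the stabilizer of \<open>w\<close>
  in \<open>GL(7)\<close> lies in \<open>SO(7)\<close>, and that the action of \<open>so(7)\<close> on \<open>w\<close> has image
  \<open>{v \<lrcorner> *w}\<close>.
\<close>

lemma infinitesimal_action:
  fixes m :: "nat \<Rightarrow> nat \<Rightarrow> real" and c :: "nat \<Rightarrow> real"
  assumes eq: "\<And>i j k. i < 7 \<Longrightarrow> j < 7 \<Longrightarrow> k < 7 \<Longrightarrow>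
    (\<Sum>n<7. m i n * w [E n, E j, E k] + m j n * w [E i, E n, E k] + m k n * w [E i, E j, E n]) =
    (\<Sum>n<7. c n * hodge h w [E n, E i, E j, E k])"
  shows "\<forall>i<7. \<forall>j<7. m i j = - m j i"
    and "\<forall>n<7. 2 * c n = (\<Sum>p<7. \<Sum>q<7. m p q * w [E n, E p, E q])"
proof -
  \<comment> \<open>Both sides are alternating in i, j, k, so increasing triples suffice: 35
    equations in the 49 + 7 unknowns \<open>m\<close> and \<open>c\<close>. The solutions form a
    space of dimension 21, a copy of so(7).\<close>
  have "\<forall>i<7. \<forall>j<7. \<forall>k<7. i < j \<and> j < k \<longrightarrow>
    (\<Sum>n<7. m i n * w [E n, E j, E k] + m j n * w [E i, E n, E k] + m k n * w [E i, E j, E n]) =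
    (\<Sum>n<7. c n * hodge h w [E n, E i, E j, E k])"
    using eq by blast
  note eqs = this[unfolded all_less_7, simplified, unfolded sum_less_7 One_nat_def]
  note w_eval [simp] hodge_w_eval [simp]
  note eqs = eqs[simplified]
  show "\<forall>i<7. \<forall>j<7. m i j = - m j i"
    unfolding all_less_7 One_nat_def using eqs by (elim conjE, intro conjI) linarith+
  show "\<forall>n<7. 2 * c n = (\<Sum>p<7. \<Sum>q<7. m p q * w [E n, E p, E q])"
    unfolding all_less_7 sum_w using eqs by simp
qed

text \<open>The hypothesis says that every \<open>E\<^sub>a \<lrcorner> R\<close> lies in \<open>g\<^sub>2\<close>.\<close>

lemma skew_torsion_unique:
  assumes R: "kform 3 R"
    and eq: "\<And>a n. a < 7 \<Longrightarrow> n < 7 \<Longrightarrow> (\<Sum>p<7. \<Sum>q<7. R [E a, E p, E q] * w [E n, E p, E q]) = 0"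
  shows "R = (\<lambda>_. 0)"
proof (rule kform_eqI[OF R kform_zero det_frame])
  \<comment> \<open>These are 49 equations in the 35 components of \<open>R\<close>. The map from
    3-forms to R^7 tensor m behind them is injective; its image omits just the 14-dimensional
    summand.\<close>
  have "\<forall>a<7. \<forall>n<7. (\<Sum>p<7. \<Sum>q<7. R [E a, E p, E q] * w [E n, E p, E q]) = 0"
    using eq by blast
  note eqs = this[unfolded all_less_7 sum_w]
  note kform_3_swap[OF R, simp]
  note eqs = eqs[simplified]
  show "\<forall>(s, a, b)\<in>set (splits 3 (frame_list e)). R a = 0"
    unfolding frame_list_E using eqs by (elim conjE) (simp add: splits_simps, linarith?)
qed

lemma vector_expand: "v = (\<Sum>n<7. h v (E n) *\<^sub>R E n)"
proof -
  have "v = (\<Sum>i\<in>UNIV. h v (e $ i) *\<^sub>R e $ i)" by (rule frame_expand[OF bilin frame])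
  also have "\<dots> = (\<Sum>n<7. h v (E n) *\<^sub>R E n)"
    unfolding sum.reindex_bij_betw[OF bij_betw_nth_7, symmetric] E_def
    by (rule sum.cong) (simp_all only: nth_frame_list lessThan_iff)
  finally show ?thesis .
qed

lemma linear_expand:
  fixes f :: "real^7 \<Rightarrow> real"
  assumes "linear f"
  shows "f v = (\<Sum>n<7. h v (E n) * f (E n))"
  by (subst vector_expand) (simp add: linear_sum[OF assms] linear_scale[OF assms])

text \<open>Transfers the sums in the definitions from the chosen frame to the adapted one.\<close>

lemma on_frame_sum:
  fixes Q :: "real^7 \<Rightarrow> real^7 \<Rightarrow> real"
  assumes "bilinear Q"
  shows "(\<Sum>i\<in>UNIV. Q (on_frame h $ i) (on_frame h $ i)) = (\<Sum>n<7. Q (E n) (E n))"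
  unfolding bilinear_frame_sum[OF inner frame on_frame[OF frame] assms] E_def
  by (rule sum_frame_list)

text \<open>The factor 2 compares ordered pairs with 2-subsets; it arises from contracting
  twice.\<close>

lemma frame_inner_2:
  assumes "kform 2 \<alpha>" "kform 2 \<beta>"
  shows "2 * frame_inner e \<alpha> \<beta> = (\<Sum>p<7. \<Sum>q<7. \<alpha> [E p, E q] * \<beta> [E p, E q])"
proof -
  have k: "kform (Suc (Suc 0)) \<alpha>" "kform (Suc (Suc 0)) \<beta>" using assms by (simp_all add: numeral_2_eq_2)
  have "frame_inner e \<mu> \<nu> = \<mu> [] * \<nu> []" if "kform 0 \<mu>" for \<mu> \<nu>
    using frame_inner_splits[OF that] by simp
  then have "frame_inner e \<mu> \<nu> = (\<Sum>q<7. \<mu> [E q] * \<nu> [E q])" if "kform (Suc 0) \<mu>" "kform (Suc 0) \<nu>" for \<mu> \<nu>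
    using frame_inner_Suc[OF that, of e]
      sum_frame_list[of "\<lambda>v. frame_inner e (v \<lrcorner> \<mu>) (v \<lrcorner> \<nu>)" e] interior_kform[OF that(1)]
    by (simp add: E_def interior_def[of _ \<mu>] interior_def[of _ \<nu>])
  note 1 = this[OF interior_kform[OF k(1)] interior_kform[OF k(2)]]
  have "2 * frame_inner e \<alpha> \<beta> = (\<Sum>p<7. frame_inner e (E p \<lrcorner> \<alpha>) (E p \<lrcorner> \<beta>))"
    using frame_inner_Suc[OF k, of e] sum_frame_list[of "\<lambda>v. frame_inner e (v \<lrcorner> \<alpha>) (v \<lrcorner> \<beta>)" e]
    by (simp add: E_def)
  then show ?thesis by (simp add: 1 interior_def)
qed

text \<open>The triples of \<open>w\<close> are the lines of a Fano plane. A pair p, q determines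
  its line, so different \<open>a\<close> and \<open>n\<close> share no term; each \<open>a\<close>
  lies on three lines, each counted in two orders.\<close>

lemma w_contraction:
  "\<forall>a<7. \<forall>n<7. (\<Sum>p<7. \<Sum>q<7. w [E a, E p, E q] * w [E n, E p, E q]) = (if a = n then 6 else 0)"
  unfolding all_less_7 sum_w by (simp add: sum_w w_eval)

lemma w_hodge_w_contraction:
  "\<forall>m<7. \<forall>a<7. \<forall>n<7. (\<Sum>p<7. \<Sum>q<7. hodge h w [E m, E a, E p, E q] * w [E n, E p, E q]) = 4 * w [E n, E m, E a]"
  unfolding all_less_7 sum_w by (simp add: w_eval hodge_w_eval)

end

section \<open>Structures without a 14-dimensional torsion component\<close>

lemma linear_mult_right:
  fixes f :: "'a::real_vector \<Rightarrow> real"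
  shows "linear f \<Longrightarrow> linear (\<lambda>v. f v * c)"
  by (intro linearI) (auto simp: linear_add linear_scale algebra_simps)

lemma linear_mult_left:
  fixes f :: "'a::real_vector \<Rightarrow> real"
  shows "linear f \<Longrightarrow> linear (\<lambda>v. c * f v)"
  by (intro linearI) (auto simp: linear_add linear_scale algebra_simps)

lemma flat_linear: "bilinear h \<Longrightarrow> linear (\<lambda>v. flat h v us)"
  by (cases us rule: remdups_adj.cases) (auto simp: flat_def bilinear_def linear_zero)

text \<open>\<open>C X\<close> stands for the Levi-Civita derivative of \<open>w\<close> along
  \<open>X\<close>. Only its formula at one point enters, so d and delta become algebraic
  expressions in \<open>C\<close>.\<close>

locale G2_torsion = adapted_frame +
  fixes \<beta> :: "real^7" and \<Gamma> :: form and lam :: real and C :: "real^7 \<Rightarrow> form"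
  assumes \<Gamma>: "\<Gamma> \<in> Lambda3_27 h w"
    and C_eq: "\<And>X vs. C X vs = - (lam / 4) * (X \<lrcorner> hodge h w) vs
      - (\<Sum>i\<in>UNIV. form_inner h
          (\<lambda>us. 1/4 * (flat h \<beta> \<and>\<^sub>w flat h X) us + 1/2 * (X \<lrcorner> \<Gamma>) us) (on_frame h $ i \<lrcorner> w)
          * (on_frame h $ i \<lrcorner> hodge h w) vs)"
begin

definition tau :: "real^7 \<Rightarrow> form" where
  "tau X us = 1/4 * (flat h \<beta> \<and>\<^sub>w flat h X) us + 1/2 * (X \<lrcorner> \<Gamma>) us"

text \<open>The coefficient of E_n _| *w in \<open>C (E a)\<close>. The Kronecker delta lets the lam
  term join the sum over \<open>n\<close>.\<close>

definition coef :: "nat \<Rightarrow> nat \<Rightarrow> real" where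
  "coef a n = - (lam / 4) * (if a = n then 1 else 0) - frame_inner e (tau (E a)) (E n \<lrcorner> w)"

abbreviation dw :: form where
  "dw \<equiv> \<lambda>vs. \<Sum>i\<in>UNIV. (flat h (on_frame h $ i) \<and>\<^sub>w C (on_frame h $ i)) vs"

lemma \<Gamma>_kform: "kform 3 \<Gamma>"
  using \<Gamma> by (simp add: Lambda3_27_def)

lemma interior_kform_3: "kform 3 \<alpha> \<Longrightarrow> kform 2 (v \<lrcorner> \<alpha>)"
  using interior_kform[of 2 \<alpha> v] by simp

lemma interior_kform_4: "kform 4 \<alpha> \<Longrightarrow> kform 3 (v \<lrcorner> \<alpha>)"
  using interior_kform[of 3 \<alpha> v] by simp

lemma flat_wedge_flat_kform: "kform 2 (flat h u \<and>\<^sub>w flat h v)"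
  using wedge_kform[OF flat_kform[OF bilin] flat_kform[OF bilin], of u v]
  by (simp add: numeral_2_eq_2)

lemma flat_wedge_3_kform: "kform 3 \<alpha> \<Longrightarrow> kform 4 (flat h u \<and>\<^sub>w \<alpha>)"
  using wedge_kform[OF flat_kform[OF bilin], of 3 \<alpha> u] by simp

lemma tau_kform: "kform 2 (tau X)"
  unfolding tau_def[abs_def]
  by (intro kform_add kform_scale flat_wedge_flat_kform interior_kform_3 \<Gamma>_kform)

lemma tau_linear: "linear (\<lambda>X. tau X us)"
  unfolding tau_def
  by (intro linear_compose_add linear_mult_left wedge_linear_right flat_linear bilin
      interior_linear[OF \<Gamma>_kform])

lemma form_inner_linear_left:
  assumes "\<And>us. linear (\<lambda>v. A v us)"
  shows "linear (\<lambda>v. form_inner h (A v) \<alpha>)"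
  unfolding form_inner_def by (intro linear_compose_sum ballI linear_mult_right assms)

lemma form_inner_linear_right:
  assumes "\<And>us. linear (\<lambda>v. A v us)"
  shows "linear (\<lambda>v. form_inner h \<alpha> (A v))"
  unfolding form_inner_def by (intro linear_compose_sum ballI linear_mult_left assms)

lemma C_tau: "C X vs = - (lam / 4) * (X \<lrcorner> hodge h w) vs
      - (\<Sum>i\<in>UNIV. form_inner h (tau X) (on_frame h $ i \<lrcorner> w) * (on_frame h $ i \<lrcorner> hodge h w) vs)"
  unfolding C_eq tau_def[abs_def] ..

lemma C_kform: "kform 3 (C X)"
  unfolding C_tau[abs_def]
  by (intro kform_diff kform_scale kform_sum interior_kform_4 hodge_w_kform)

lemma C_linear: "linear (\<lambda>X. C X us)"
  unfolding C_tau
  by (intro linear_compose_sub linear_mult_left linear_compose_sum ballI linear_mult_right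
      form_inner_linear_left tau_linear interior_linear[OF hodge_w_kform])

lemma C_frame:
  assumes "a < 7"
  shows "C (E a) vs = (\<Sum>n<7. coef a n * hodge h w (E n # vs))"
proof -
  have "bilinear (\<lambda>x y. form_inner h (tau (E a)) (x \<lrcorner> w) * (y \<lrcorner> hodge h w) vs)"
    unfolding bilinear_def
    by (intro conjI allI linear_mult_left linear_mult_right form_inner_linear_right
        interior_linear[OF w_kform] interior_linear[OF hodge_w_kform])
  note * = on_frame_sum[OF this]
  have F: "form_inner h (tau (E a)) (E n \<lrcorner> w) = frame_inner e (tau (E a)) (E n \<lrcorner> w)" for n
    by (rule form_inner_frame[OF inner frame tau_kform interior_kform_3[OF w_kform]])
  have "C (E a) vs = - (lam / 4) * hodge h w (E a # vs)
      - (\<Sum>n<7. frame_inner e (tau (E a)) (E n \<lrcorner> w) * hodge h w (E n # vs))"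
    unfolding C_tau * F by (simp only: interior_def[of _ "hodge h w"])
  moreover have "(\<Sum>n<7. - (lam / 4) * (if a = n then 1 else 0) * hodge h w (E n # vs)) =
      - (lam / 4) * hodge h w (E a # vs)"
  proof -
    have "(\<Sum>n<7. - (lam / 4) * (if a = n then 1 else 0) * hodge h w (E n # vs)) =
        (\<Sum>n<7. if a = n then - (lam / 4) * hodge h w (E n # vs) else 0)"
      by (rule sum.cong) auto
    then show ?thesis using assms by simp
  qed
  ultimately show ?thesis
    by (simp only: coef_def left_diff_distrib sum_subtractf)
qed

lemma tau_E:
  "tau (E a) [E p, E q] = 1/4 * (h \<beta> (E p) * h (E a) (E q) - h \<beta> (E q) * h (E a) (E p)) + 1/2 * \<Gamma> [E a, E p, E q]"
  by (simp add: tau_def interior_def wedge_splits[OF flat_kform[OF bilin]] splits_simps flat_def)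

lemma coef_eq:
  "2 * coef a n = - (lam / 2) * (if a = n then 1 else 0) - (\<Sum>p<7. \<Sum>q<7. tau (E a) [E p, E q] * w [E n, E p, E q])"
  using frame_inner_2[OF tau_kform interior_kform_3[OF w_kform], of "E a" "E n"]
  by (simp add: coef_def interior_def)

lemma wedge_beta_w: "(flat h \<beta> \<and>\<^sub>w w) [x, y, z, u] =
    h \<beta> x * w [y, z, u] - h \<beta> y * w [x, z, u] + h \<beta> z * w [x, y, u] - h \<beta> u * w [x, y, z]"
  by (simp add: wedge_splits[OF flat_kform[OF bilin]] splits_simps flat_def)

text \<open>The sign is (-1)^3, from moving the 1-form past the 3-form \<open>w\<close>.\<close>

lemma hodge_wedge_beta_w: "hodge h (flat h \<beta> \<and>\<^sub>w w) = (\<lambda>vs. - (\<beta> \<lrcorner> hodge h w) vs)"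
proof (rule kform_eqI[OF _ _ det_frame])
  have k: "kform 4 (flat h \<beta> \<and>\<^sub>w w)" by (rule flat_wedge_3_kform[OF w_kform])
  show "kform 3 (hodge h (flat h \<beta> \<and>\<^sub>w w))" by (rule hodge_kform[OF bilin k]) simp
  show "kform 3 (\<lambda>vs. - (\<beta> \<lrcorner> hodge h w) vs)"
    by (intro kform_uminus interior_kform_4 hodge_w_kform)
  have *: "(\<beta> \<lrcorner> hodge h w) us = (\<Sum>n<7. h \<beta> (E n) * hodge h w (E n # us))" for us
    unfolding interior_def by (rule linear_expand[OF interior_linear[OF hodge_w_kform], unfolded interior_def])
  note 4 = hodge_4[OF k, unfolded splits_simps, simplified, unfolded wedge_beta_w, simplified w_eval, simplified]
  show "\<forall>(s, a, b)\<in>set (splits 3 (frame_list e)). hodge h (flat h \<beta> \<and>\<^sub>w w) a = - (\<beta> \<lrcorner> hodge h w) a"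
    unfolding frame_list_E * sum_less_7 One_nat_def by (simp add: splits_simps 4 hodge_w_eval)
qed

text \<open>The shuffle signs of a triple and of its complement multiply to (-1)^(3*4) = 1.\<close>

lemma hodge_hodge_3:
  assumes "kform 3 \<alpha>"
  shows "hodge h (hodge h \<alpha>) = \<alpha>"
proof (rule kform_eqI[OF _ assms det_frame])
  have k: "kform 4 (hodge h \<alpha>)" by (rule hodge_kform[OF bilin assms]) simp
  show "kform 3 (hodge h (hodge h \<alpha>))" by (rule hodge_kform[OF bilin k]) simp
  note 3 = hodge_3[OF assms, unfolded splits_simps, simplified]
  note 4 = hodge_4[OF k, unfolded splits_simps, simplified]
  show "\<forall>(s, a, b)\<in>set (splits 3 (frame_list e)). hodge h (hodge h \<alpha>) a = \<alpha> a"
    unfolding frame_list_E by (simp add: splits_simps 3 4)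
qed

end

lemma hodge_add: "hodge h (\<lambda>vs. \<alpha> vs + \<beta> vs) us = hodge h \<alpha> us + hodge h \<beta> us"
  by (simp add: hodge_def distrib_right sum.distrib)

lemma hodge_scale: "hodge h (\<lambda>vs. c * \<alpha> vs) us = c * hodge h \<alpha> us"
  by (simp add: hodge_def sum_distrib_left mult.assoc)

section \<open>Differential, codifferential and torsion\<close>

context G2_torsion
begin

lemma wedge_\<Gamma>_w: "(\<Sum>(s, a, b)\<leftarrow>splits 3 vs. s * \<Gamma> a * w b) = 0"
  using \<Gamma> wedge_splits[OF \<Gamma>_kform, of w vs] by (simp add: Lambda3_27_def)

lemma wedge_\<Gamma>_hodge_w: "(\<Sum>(s, a, b)\<leftarrow>splits 3 vs. s * \<Gamma> a * hodge h w b) = 0"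
  using \<Gamma> wedge_splits[OF \<Gamma>_kform, of "hodge h w" vs] by (simp add: Lambda3_27_def)

text \<open>The 35 - 27 = 8 equations that cut out \<open>Lambda3_27\<close>: seven components of a
  6-form and one of a 7-form.\<close>

lemmas \<Gamma>_constraints =
  wedge_\<Gamma>_w[of "[E 1, E 2, E 3, E 4, E 5, E 6]", unfolded splits_simps One_nat_def, simplified, simplified w_eval, simplified]
  wedge_\<Gamma>_w[of "[E 0, E 2, E 3, E 4, E 5, E 6]", unfolded splits_simps One_nat_def, simplified, simplified w_eval, simplified]
  wedge_\<Gamma>_w[of "[E 0, E 1, E 3, E 4, E 5, E 6]", unfolded splits_simps One_nat_def, simplified, simplified w_eval, simplified]
  wedge_\<Gamma>_w[of "[E 0, E 1, E 2, E 4, E 5, E 6]", unfolded splits_simps One_nat_def, simplified, simplified w_eval, simplified]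
  wedge_\<Gamma>_w[of "[E 0, E 1, E 2, E 3, E 5, E 6]", unfolded splits_simps One_nat_def, simplified, simplified w_eval, simplified]
  wedge_\<Gamma>_w[of "[E 0, E 1, E 2, E 3, E 4, E 6]", unfolded splits_simps One_nat_def, simplified, simplified w_eval, simplified]
  wedge_\<Gamma>_w[of "[E 0, E 1, E 2, E 3, E 4, E 5]", unfolded splits_simps One_nat_def, simplified, simplified w_eval, simplified]
  wedge_\<Gamma>_hodge_w[of "[E 0, E 1, E 2, E 3, E 4, E 5, E 6]", unfolded splits_simps One_nat_def, simplified, simplified hodge_w_eval, simplified]

lemma coef_values:
  "\<forall>a<7. \<forall>n<7. coef a n = - (lam / 4) * (if a = n then 1 else 0)
     - (\<Sum>p<7. \<Sum>q<7. tau (E a) [E p, E q] * w [E n, E p, E q]) / 2"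
  using coef_eq by (simp add: field_simps)

lemmas coef_eval = coef_values[unfolded all_less_7 sum_w tau_E, unfolded One_nat_def,
    simplified h_E kform_3_swap[OF \<Gamma>_kform], simplified]

lemma dw_E: "dw vs = (\<Sum>n<7. (flat h (E n) \<and>\<^sub>w C (E n)) vs)"
proof (rule on_frame_sum[where Q = "\<lambda>x y. (flat h x \<and>\<^sub>w C y) vs"])
  show "bilinear (\<lambda>x y. (flat h x \<and>\<^sub>w C y) vs)"
    unfolding bilinear_def
    by (intro conjI allI wedge_linear_left wedge_linear_right flat_linear bilin C_linear)
qed

lemma dw_kform: "kform 4 dw"
  by (intro kform_sum flat_wedge_3_kform C_kform)

lemma flat_wedge_C_E: "(flat h (E n) \<and>\<^sub>w C (E n)) [x, y, z, u] =
    h (E n) x * C (E n) [y, z, u] - h (E n) y * C (E n) [x, z, u]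
    + h (E n) z * C (E n) [x, y, u] - h (E n) u * C (E n) [x, y, z]"
  by (simp add: wedge_splits[OF flat_kform[OF bilin]] splits_simps flat_def)

lemma dw_at_frame:
  assumes "i < 7" "j < 7" "k < 7" "l < 7"
  shows "dw [E i, E j, E k, E l] =
    C (E i) [E j, E k, E l] - C (E j) [E i, E k, E l] + C (E k) [E i, E j, E l] - C (E l) [E i, E j, E k]"
proof -
  have *: "(\<Sum>n<7. h (E n) (E m) * f n) = f m" if "m < 7" for m and f :: "nat \<Rightarrow> real"
  proof -
    have "(\<Sum>n<7. h (E n) (E m) * f n) = (\<Sum>n<7. if n = m then f n else 0)"
      using that by (intro sum.cong) (auto simp: h_E)
    then show ?thesis using that by simp
  qed
  show ?thesis
    unfolding dw_E flat_wedge_C_E sum.distrib sum_subtractf using assms by (simp only: *)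
qed

lemmas C_E = C_frame[unfolded sum_less_7 One_nat_def]

text \<open>Antisymmetrizing X _| *w counts *w four times, which turns -lam/4 into -lam.\<close>

lemma dw_eq:
  "dw = (\<lambda>vs. - lam * hodge h w vs + hodge h \<Gamma> vs + 3/4 * (flat h \<beta> \<and>\<^sub>w w) vs)"
proof (rule kform_eqI[OF dw_kform _ det_frame])
  show "kform 4 (\<lambda>vs. - lam * hodge h w vs + hodge h \<Gamma> vs + 3/4 * (flat h \<beta> \<and>\<^sub>w w) vs)"
    by (intro kform_add kform_scale hodge_w_kform flat_wedge_3_kform w_kform hodge_kform[OF bilin \<Gamma>_kform]) simp
  note 3 = hodge_3[OF \<Gamma>_kform, unfolded splits_simps, simplified]
  show "\<forall>(s, a, b)\<in>set (splits 4 (frame_list e)).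
      dw a = - lam * hodge h w a + hodge h \<Gamma> a + 3/4 * (flat h \<beta> \<and>\<^sub>w w) a"
    unfolding frame_list_E
    \<comment> \<open>What remains are linear identities in lam, the \<open>h \<beta> (E n)\<close>
      and the components of \<Gamma>, valid modulo the eight constraints.\<close>
    by (simp add: splits_simps dw_at_frame C_E hodge_w_eval wedge_beta_w w_eval 3 coef_eval)
      (intro conjI; insert \<Gamma>_constraints; argo)
qed

text \<open>|*w|^2 = 7, and the other two summands of dw are orthogonal to *w; for *\<Gamma> this is
  the constraint \<Gamma> ^ *w = 0.\<close>

lemma form_inner_dw: "form_inner h dw (hodge h w) = - 7 * lam"
proof -
  note 3 = hodge_3[OF \<Gamma>_kform, unfolded splits_simps, simplified]
  have "form_inner h dw (hodge h w) = (\<Sum>(s, a, b)\<leftarrow>splits 4 (frame_list e). dw a * hodge h w a)"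
    unfolding form_inner_frame[OF inner frame dw_kform hodge_w_kform] by (rule frame_inner_splits[OF dw_kform])
  also have "\<dots> = - 7 * lam"
    unfolding frame_list_E using \<Gamma>_constraints
    by (simp add: splits_simps hodge_w_eval fun_cong[OF dw_eq] wedge_beta_w w_eval 3)
  finally show ?thesis .
qed

text \<open>Contraction sees only the skew part of \<open>coef\<close>. The lam term is a multiple
  of the identity, and the \<Gamma> term is symmetric by the constraints, so only \<beta>
  survives.\<close>

lemma codiff_eq:
  "- (\<Sum>i\<in>UNIV. (on_frame h $ i \<lrcorner> C (on_frame h $ i)) vs) = - (\<beta> \<lrcorner> w) vs"
proof -
  have "bilinear (\<lambda>x y. (x \<lrcorner> C y) vs)"
    unfolding bilinear_def
    by (auto intro: interior_linear[OF C_kform] C_linear simp: interior_def[of _ "C _"])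
      (use interior_linear[OF C_kform] in \<open>simp add: interior_def\<close>)
  then have "(\<Sum>i\<in>UNIV. (on_frame h $ i \<lrcorner> C (on_frame h $ i)) vs) = (\<Sum>n<7. (E n \<lrcorner> C (E n)) vs)"
    by (rule on_frame_sum)
  moreover have "(\<lambda>vs. \<Sum>n<7. (E n \<lrcorner> C (E n)) vs) = (\<beta> \<lrcorner> w)"
  proof (rule kform_eqI[OF _ _ det_frame])
    show "kform 2 (\<lambda>vs. \<Sum>n<7. (E n \<lrcorner> C (E n)) vs)" by (intro kform_sum interior_kform_3 C_kform)
    show "kform 2 (\<beta> \<lrcorner> w)" by (rule interior_kform_3[OF w_kform])
    have *: "(\<beta> \<lrcorner> w) us = (\<Sum>n<7. h \<beta> (E n) * w (E n # us))" for us
      unfolding interior_def by (rule linear_expand[OF interior_linear[OF w_kform], unfolded interior_def])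
    have C: "(E n \<lrcorner> C (E n)) us = C (E n) (E n # us)" for n us by (simp add: interior_def)
    show "\<forall>(s, a, b)\<in>set (splits 2 (frame_list e)). (\<Sum>n<7. (E n \<lrcorner> C (E n)) a) = (\<beta> \<lrcorner> w) a"
      unfolding frame_list_E sum_less_7 * C One_nat_def
      by (simp add: splits_simps C_E hodge_w_eval w_eval coef_eval) (intro conjI; insert \<Gamma>_constraints; argo)
  qed
  ultimately show ?thesis by (simp add: fun_eq_iff)
qed

lemma torsion_eq:
  fixes B :: "real^7 \<Rightarrow> real^7 \<Rightarrow> real^7"
  assumes T: "kform 3 T"
    and T_eq: "\<And>u v x. T [u, v, x] = h (B u v - B v u) x"
    and C_B: "\<And>u vs. C u vs = (\<Sum>i<length vs. w (vs[i := B u (vs ! i)]))"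
  shows "T vs = 1/6 * form_inner h dw (hodge h w) * w vs - hodge h dw vs
    + hodge h (flat h \<beta> \<and>\<^sub>w w) vs"
proof -
  define m where "m a i n = h (B (E a) (E i)) (E n)" for a i n
  have lin: "linear (\<lambda>v. w [v, y, z])" "linear (\<lambda>v. w [x, v, z])" "linear (\<lambda>v. w [x, y, v])" for x y z
    using kform_linear[OF w_kform, of "[]" "[y, z]"] kform_linear[OF w_kform, of "[x]" "[z]"]
      kform_linear[OF w_kform, of "[x, y]" "[]"] by simp_all
  have act: "C (E a) [E i, E j, E k] =
      (\<Sum>n<7. m a i n * w [E n, E j, E k] + m a j n * w [E i, E n, E k] + m a k n * w [E i, E j, E n])" for a i j k
  proof -
    have "C (E a) [E i, E j, E k] =
        w [B (E a) (E i), E j, E k] + w [E i, B (E a) (E j), E k] + w [E i, E j, B (E a) (E k)]"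
      by (simp add: C_B eval_nat_numeral lessThan_Suc)
    also have "w [B (E a) (E i), E j, E k] = (\<Sum>n<7. m a i n * w [E n, E j, E k])"
      unfolding m_def by (rule linear_expand[OF lin(1)])
    also have "w [E i, B (E a) (E j), E k] = (\<Sum>n<7. m a j n * w [E i, E n, E k])"
      unfolding m_def by (rule linear_expand[OF lin(2)])
    also have "w [E i, E j, B (E a) (E k)] = (\<Sum>n<7. m a k n * w [E i, E j, E n])"
      unfolding m_def by (rule linear_expand[OF lin(3)])
    finally show ?thesis by (simp only: sum.distrib)
  qed
  have eq: "(\<Sum>n<7. m a i n * w [E n, E j, E k] + m a j n * w [E i, E n, E k] + m a k n * w [E i, E j, E n])
      = (\<Sum>n<7. coef a n * hodge h w [E n, E i, E j, E k])" if "a < 7" for a i j k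
    using act C_frame[OF that] by metis
  have skew: "m a i j = - m a j i" if "a < 7" "i < 7" "j < 7" for a i j
    using infinitesimal_action(1)[OF eq] that by blast
  have coef_m: "2 * coef a n = (\<Sum>p<7. \<Sum>q<7. m a p q * w [E n, E p, E q])" if "a < 7" "n < 7" for a n
    using infinitesimal_action(2)[OF eq] that by blast
  have Tm: "T [E a, E i, E j] = m a i j - m i a j" for a i j
    using bilin by (simp add: T_eq m_def bilinear_lsub)
  \<comment> \<open>As in the Koszul formula: of the three cyclic instances of \<open>Tm\<close>,
    the first minus the second plus the third is 2 m a i j by skewness, and the values of
    \<open>T\<close> agree.\<close>
  have mT: "2 * m a i j = T [E a, E i, E j]" if "a < 7" "i < 7" "j < 7" for a i j
  proof -
    have "T [E i, E j, E a] = T [E a, E i, E j]" "T [E j, E a, E i] = T [E a, E i, E j]"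
      using kform_move[OF T, of "[]" "E a" "[E i, E j]" "[]"] kform_move[OF T, of "[]" "E j" "[E a, E i]" "[]"]
      by simp_all
    then show ?thesis
      using skew[OF that] skew[of i j a] skew[of j a i] that by (simp add: Tm)
  qed
  \<comment> \<open>\<open>T\<close> minus its expected value. The coefficients are chosen so that
    all pairings vanish: \<open>T\<close> pairs to \<open>4 * coef a n\<close>, while
    \<open>w\<close> and \<beta> _| *w contribute the factors 6 and 4 of the contraction
    lemmas.\<close>
  let ?R = "\<lambda>vs. T vs + lam / 6 * w vs + \<Gamma> vs + 1/4 * (\<beta> \<lrcorner> hodge h w) vs"
  have "?R = (\<lambda>_. 0)"
  proof (rule skew_torsion_unique)
    show "kform 3 ?R"
      by (intro kform_add kform_scale interior_kform_4 hodge_w_kform T w_kform \<Gamma>_kform)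
    fix a n :: nat assume an: "a < 7" "n < 7"
    let ?S = "\<lambda>f. \<Sum>p<7. \<Sum>q<7. f p q * w [E n, E p, E q] :: real"
    have S_add: "?S (\<lambda>p q. f p q + g p q) = ?S f + ?S g" for f g
      by (simp add: distrib_right sum.distrib)
    have S_scale: "?S (\<lambda>p q. c * f p q) = c * ?S f" for c f
      by (simp add: sum_distrib_left mult.assoc)
    have 1: "?S (\<lambda>p q. T [E a, E p, E q]) = 4 * coef a n"
      using coef_m[OF an] S_scale[of 2 "m a"] an by (simp add: mT)
    have 2: "?S (\<lambda>p q. w [E a, E p, E q]) = (if a = n then 6 else 0)"
      using w_contraction an by blast
    have 3: "?S (\<lambda>p q. (\<beta> \<lrcorner> hodge h w) [E a, E p, E q]) = 4 * (\<Sum>m<7. h \<beta> (E m) * w [E n, E m, E a])"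
    proof -
      have "(\<beta> \<lrcorner> hodge h w) us = (\<Sum>m<7. h \<beta> (E m) * hodge h w (E m # us))" for us
        unfolding interior_def by (rule linear_expand[OF interior_linear[OF hodge_w_kform], unfolded interior_def])
      then have "?S (\<lambda>p q. (\<beta> \<lrcorner> hodge h w) [E a, E p, E q]) =
          (\<Sum>p<7. \<Sum>q<7. \<Sum>m<7. h \<beta> (E m) * (hodge h w [E m, E a, E p, E q] * w [E n, E p, E q]))"
        by (simp add: sum_distrib_right mult.assoc)
      also have "\<dots> = (\<Sum>p<7. \<Sum>m<7. \<Sum>q<7. h \<beta> (E m) * (hodge h w [E m, E a, E p, E q] * w [E n, E p, E q]))"
        by (rule sum.cong[OF refl], rule sum.swap)
      also have "\<dots> = (\<Sum>m<7. \<Sum>p<7. \<Sum>q<7. h \<beta> (E m) * (hodge h w [E m, E a, E p, E q] * w [E n, E p, E q]))"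
        by (rule sum.swap)
      also have "\<dots> = (\<Sum>m<7. h \<beta> (E m) * (4 * w [E n, E m, E a]))"
        unfolding sum_distrib_left[symmetric] using w_hodge_w_contraction an by (intro sum.cong) auto
      finally show ?thesis by (simp add: sum_distrib_left mult.left_commute)
    qed
    have 4: "?S (\<lambda>p q. h \<beta> (E p) * h (E a) (E q)) = (\<Sum>m<7. h \<beta> (E m) * w [E n, E m, E a])"
    proof (rule sum.cong[OF refl])
      fix p :: nat
      have "(\<Sum>q<7. h \<beta> (E p) * h (E a) (E q) * w [E n, E p, E q]) =
          (\<Sum>q<7. if a = q then h \<beta> (E p) * w [E n, E p, E q] else 0)"
        using an by (intro sum.cong) (auto simp: h_E)
      then show "(\<Sum>q<7. h \<beta> (E p) * h (E a) (E q) * w [E n, E p, E q]) = h \<beta> (E p) * w [E n, E p, E a]"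
        using an by simp
    qed
    \<comment> \<open>Exchanging p and q makes the two halves of \<beta> ^ E_a contribute
      equally.\<close>
    have 5: "?S (\<lambda>p q. h \<beta> (E q) * h (E a) (E p)) = - (\<Sum>m<7. h \<beta> (E m) * w [E n, E m, E a])"
    proof -
      have swap: "w [E n, E p, E q] = - w [E n, E q, E p]" for p q
        by (rule kform_swap[OF w_kform, of "[E n]" "E p" "E q" "[]", unfolded append.simps])
      have "?S (\<lambda>p q. h \<beta> (E q) * h (E a) (E p)) =
          (\<Sum>p<7. \<Sum>q<7. - (h \<beta> (E q) * h (E a) (E p) * w [E n, E q, E p]))"
        by (intro sum.cong refl) (subst swap, simp)
      also have "\<dots> = - ?S (\<lambda>p q. h \<beta> (E p) * h (E a) (E q))"
        by (subst sum.swap) (simp add: sum_negf)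
      finally show ?thesis by (simp only: 4)
    qed
    have tau: "tau (E a) [E p, E q] = 1/4 * (h \<beta> (E p) * h (E a) (E q)) + (- 1/4) * (h \<beta> (E q) * h (E a) (E p))
        + 1/2 * \<Gamma> [E a, E p, E q]" for p q
      by (simp add: tau_E algebra_simps)
    have "2 * coef a n = - (lam / 2) * (if a = n then 1 else 0) - ?S (\<lambda>p q. tau (E a) [E p, E q])"
      by (rule coef_eq)
    then have "4 * coef a n = - lam * (if a = n then 1 else 0) - ?S (\<lambda>p q. \<Gamma> [E a, E p, E q])
        - (\<Sum>m<7. h \<beta> (E m) * w [E n, E m, E a])"
      unfolding tau S_add S_scale 4 5 by (simp split: if_splits)
    then show "?S (\<lambda>p q. ?R [E a, E p, E q]) = 0"
      unfolding S_add S_scale 1 2 3 by (simp split: if_splits)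
  qed
  then have "T vs = - (lam / 6) * w vs - \<Gamma> vs - 1/4 * (\<beta> \<lrcorner> hodge h w) vs"
    by (auto simp: fun_eq_iff dest: spec[of _ vs])
  moreover have "hodge h dw vs = - lam * w vs + \<Gamma> vs + 3/4 * hodge h (flat h \<beta> \<and>\<^sub>w w) vs"
  proof -
    have "hodge h dw vs = - lam * hodge h (hodge h w) vs + hodge h (hodge h \<Gamma>) vs
        + 3/4 * hodge h (flat h \<beta> \<and>\<^sub>w w) vs"
      unfolding dw_eq hodge_add hodge_scale ..
    then show ?thesis by (simp add: hodge_hodge_3 w_kform \<Gamma>_kform)
  qed
  \<comment> \<open>The coefficients match: -7/6 + 1 = -1/6 for \<open>w\<close>, and 1 - 3/4 = 1/4
    for the star of \<beta> ^ w.\<close>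
  ultimately show ?thesis
    unfolding form_inner_dw hodge_wedge_beta_w by simp
qed

end

section \<open>From connections on the manifold to one tangent space\<close>

lemma kform_update_diff:
  assumes "kform k \<alpha>" "i < length vs"
  shows "\<alpha> (vs[i := a - b]) = \<alpha> (vs[i := a]) - \<alpha> (vs[i := b])"
proof (cases "length vs = k")
  case True
  then have "linear (\<lambda>v. \<alpha> (vs[i := v]))" using assms unfolding kform_def by blast
  then show ?thesis by (rule linear_diff)
next
  case False
  then show ?thesis by (simp add: kform_length[OF assms(1)])
qed

lemma torsion_form_constant:
  "torsion_form g N c p [u, v, x] = g c p (N c p u v - N c p v u) x"
  by (simp add: torsion_form_def cov_vec_def lie_bracket_def frechet_derivative_const)

theorem theorem4p8:
  fixes M :: "'m topology" and A :: "'m chart set"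
    and g :: "'m metr" and \<omega> :: "'m fform"
    and LC N :: "'m conn"
    and lam :: "'m \<Rightarrow> real" and \<beta> :: "'m vfield" and \<Gamma> :: "'m fform"
  assumes "oriented_manifold7 M A"
    and "riemannian_metric A g"
    and "levi_civita A g LC"
    and "G2_structure M A g \<omega>"
    and "G2_type_1_7_27 A g LC \<omega> lam \<beta> \<Gamma>"
    and "affine_connection A N"
    and "parallel_form A N \<omega>"
    and "\<forall>c\<in>A. \<forall>p\<in>fst c. kform 3 (torsion_form g N c p)"
  shows "\<forall>c\<in>A. \<forall>p\<in>fst c. \<forall>vs.
    (let h = g c p; w = \<omega> c p; dw = ext_d g LC \<omega> c p; b = flat h (\<beta> c p) in
      torsion_form g N c p vs =
        1/6 * form_inner h dw (hodge h w) * w vs - hodge h dw vs + hodge h (b \<and>\<^sub>w w) vs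
    \<and> codiff g LC \<omega> c p vs = - (\<beta> c p \<lrcorner> w) vs
    \<and> dw vs =
        1/7 * form_inner h dw (hodge h w) * hodge h w vs + hodge h (\<Gamma> c p) vs
        + 3/4 * (b \<and>\<^sub>w w) vs)"
proof (intro ballI allI)
  fix c p vs assume c: "c \<in> A" and p: "p \<in> fst c"
  let ?h = "g c p" and ?w = "\<omega> c p" and ?C = "cov_form LC \<omega> c p"
  have h: "inner_product ?h"
    using assms(2) c p unfolding riemannian_metric_def inner_product_def by blast
  obtain e where e: "oriented_orthonormal ?h e" "?w = standard_G2_form ?h e"
    using assms(4) c p unfolding G2_structure_def by blast
  interpret G2_torsion ?h e ?w "\<beta> c p" "\<Gamma> c p" "lam p" ?C
  proof
    show "\<Gamma> c p \<in> Lambda3_27 ?h ?w"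
      using assms(5) c p by (simp add: G2_type_1_7_27_def)
    show "?C X vs = - (lam p / 4) * (X \<lrcorner> hodge ?h ?w) vs
      - (\<Sum>i\<in>UNIV. form_inner ?h
          (\<lambda>us. 1/4 * (flat ?h (\<beta> c p) \<and>\<^sub>w flat ?h X) us + 1/2 * (X \<lrcorner> \<Gamma> c p) us) (on_frame ?h $ i \<lrcorner> ?w)
          * (on_frame ?h $ i \<lrcorner> hodge ?h ?w) vs)" for X vs
      using assms(5) c p unfolding G2_type_1_7_27_def Let_def by blast
  qed (use h e in auto)
  \<comment> \<open>The difference of two connections is a tensor, so Christoffel symbols in a
    single chart suffice.\<close>
  define B where "B u v = N c p u v - LC c p u v" for u v
  have "LC c p u v = LC c p v u" for u v
  proof -
    have "torsion_form g LC c p vs = 0" for vs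
      using assms(3) c p unfolding levi_civita_def by blast
    then have "?h (LC c p u v - LC c p v u) x = 0" for x by (simp flip: torsion_form_constant)
    then show ?thesis using h unfolding inner_product_def by (metis less_irrefl right_minus_eq)
  qed
  then have T_eq: "torsion_form g N c p [u, v, x] = ?h (B u v - B v u) x" for u v x
    by (simp add: torsion_form_constant B_def)
  \<comment> \<open>Both covariant derivatives contain the same derivative of the components of
    \<omega>; it cancels because the one for \<open>N\<close> is zero.\<close>
  have C_B: "?C u vs = (\<Sum>i<length vs. ?w (vs[i := B u (vs ! i)]))" for u vs
  proof -
    have "cov_form N \<omega> c p u vs = 0"
      using assms(7) c p unfolding parallel_form_def by blast
    then show ?thesis
      by (simp add: cov_form_def B_def kform_update_diff[OF w_kform] sum_subtractf)
  qed
  have T: "kform 3 (torsion_form g N c p)" using assms(8) c p by blast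
  have d: "ext_d g LC \<omega> c p = dw" by (simp add: ext_d_def Let_def fun_eq_iff)
  have cod: "codiff g LC \<omega> c p vs = - (\<beta> c p \<lrcorner> ?w) vs"
    using codiff_eq[of vs] by (simp add: codiff_def Let_def)
  have dw: "dw vs = 1/7 * form_inner ?h dw (hodge ?h ?w) * hodge ?h ?w vs + hodge ?h (\<Gamma> c p) vs
      + 3/4 * (flat ?h (\<beta> c p) \<and>\<^sub>w ?w) vs"
    unfolding form_inner_dw by (simp add: fun_cong[OF dw_eq])
  show "let h = g c p; w = \<omega> c p; dw = ext_d g LC \<omega> c p; b = flat h (\<beta> c p) in
      torsion_form g N c p vs =
        1/6 * form_inner h dw (hodge h w) * w vs - hodge h dw vs + hodge h (b \<and>\<^sub>w w) vs
    \<and> codiff g LC \<omega> c p vs = - (\<beta> c p \<lrcorner> w) vs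
    \<and> dw vs =
        1/7 * form_inner h dw (hodge h w) * hodge h w vs + hodge h (\<Gamma> c p) vs
        + 3/4 * (b \<and>\<^sub>w w) vs"
    unfolding Let_def d using torsion_eq[OF T T_eq C_B, of vs] cod dw by (intro conjI)
qed

end
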